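(* Let $1\le k\le n$ be integers. For any $r\in[0,1]$, any $s\in[0,\frac1r]$ and any $K\in\mathbb{C}^{n\times n}$, the function $$A\ \longmapsto\ \phi\big((K^*A^rK)^s\big)$$ is concave on $\mathbf{H}_n^+$.
   Context: $\mathbf{H}_n^+$ is the convex cone of $n\times n$ Hermitian positive semidefinite matrices. For a square matrix $X$ of size at least $k$, $\mathrm{Tr}_k[X]$ denotes the $k$-th elementary symmetric polynomial of the eigenvalues of $X$ (equivalently, the sum of all $k\times k$ principal minors of $X$), and $\phi(X)=(\mathrm{Tr}_k[X])^{1/k}$ for the fixed integer $k$. Powers of positive semidefinite matrices are defined by the spectral functional calculus. Conventions: when $r=0$ the interval $[0,\frac1r]$ is read as $[0,+\infty)$, and $X^0=I$ for positive semidefinite $X$. *)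

theory Defs
  imports "HOL-Analysis.Analysis" "HOL-Computational_Algebra.Fundamental_Theorem_Algebra"
begin

definition ctranspose :: "complex^'n^'m \<Rightarrow> complex^'m^'n" where
  "ctranspose A = map_matrix cnj (transpose A)"

definition hermitian :: "complex^'n^'n \<Rightarrow> bool" where
  "hermitian A \<longleftrightarrow> ctranspose A = A"

definition unitary :: "complex^'n^'n \<Rightarrow> bool" where
  "unitary U \<longleftrightarrow> ctranspose U ** U = mat 1"

definition diag_mat :: "('n \<Rightarrow> 'a::zero) \<Rightarrow> 'a^'n^'n" where
  "diag_mat d = (\<chi> i j. if i = j then d i else 0)"

definition quad_form :: "complex^'n^'n \<Rightarrow> complex^'n \<Rightarrow> complex" where
  "quad_form A v = (\<Sum>i\<in>UNIV. \<Sum>j\<in>UNIV. cnj (v $ i) * A $ i $ j * v $ j)"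

text \<open>For Hermitian matrices the quadratic form is real, so the real part loses nothing.\<close>

definition psd_cone :: "(complex^'n^'n) set" where
  "psd_cone = {A. hermitian A \<and> (\<forall>v. 0 \<le> Re (quad_form A v))}"

text \<open>Only meaningful for Hermitian \<open>A\<close>, which is unitarily diagonalisable with real
  eigenvalues; the lemma \<open>spectral_fun_eqI\<close> below shows that the result does not depend on the
  chosen diagonalisation.\<close>

definition spectral_fun :: "(real \<Rightarrow> real) \<Rightarrow> complex^'n^'n \<Rightarrow> complex^'n^'n" where
  "spectral_fun f A = (THE B. \<exists>U d. unitary U
      \<and> A = U ** diag_mat (\<lambda>i. of_real (d i)) ** ctranspose U
      \<and> B = U ** diag_mat (\<lambda>i. of_real (f (d i))) ** ctranspose U)"

text \<open>The case distinction implements the convention \<open>X\<^sup>0 = I\<close>, because \<open>0 powr 0 = 0\<close>.\<close>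

definition psd_power :: "complex^'n^'n \<Rightarrow> real \<Rightarrow> complex^'n^'n" where
  "psd_power A r = spectral_fun (\<lambda>x. if r = 0 then 1 else x powr r) A"

definition charpoly :: "'a::comm_ring_1^'n^'n \<Rightarrow> 'a poly" where
  "charpoly A = det (mat [:0, 1:] - map_matrix (\<lambda>a. [:a:]) A)"

text \<open>Some enumeration of the eigenvalues with algebraic multiplicity; only symmetric functions
  of it are meaningful.\<close>

definition eigenvals :: "complex^'n^'n \<Rightarrow> 'n \<Rightarrow> complex" where
  "eigenvals A = (SOME d. charpoly A = (\<Prod>i\<in>UNIV. [:- d i, 1:]))"

definition elem_sym :: "nat \<Rightarrow> ('n::finite \<Rightarrow> 'a::comm_ring_1) \<Rightarrow> 'a" where
  "elem_sym k d = (\<Sum>I | card I = k. \<Prod>i\<in>I. d i)"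

definition trace_k :: "nat \<Rightarrow> complex^'n^'n \<Rightarrow> complex" where
  "trace_k k A = elem_sym k (eigenvals A)"

text \<open>Applied to positive semidefinite matrices only, where \<open>trace_k\<close> is real and nonnegative.\<close>

definition phi :: "nat \<Rightarrow> complex^'n^'n \<Rightarrow> real" where
  "phi k A = Re (trace_k k A) powr (1 / real k)"


subsection \<open>Well-definedness\<close>

lemma diag_mat_mult_left: "(diag_mat d ** M) $ i $ j = d i * M $ i $ j"
  for d :: "'n::finite \<Rightarrow> 'a::semiring_1"
  by (simp add: diag_mat_def matrix_matrix_mult_def if_distrib[of "\<lambda>x. x * _"] cong: if_cong)

lemma diag_mat_mult_right: "(M ** diag_mat d) $ i $ j = M $ i $ j * d j"
  for d :: "'n::finite \<Rightarrow> 'a::semiring_1"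
  by (simp add: diag_mat_def matrix_matrix_mult_def if_distrib[of "\<lambda>x. _ * x"] cong: if_cong)

lemma spectral_fun_unique:
  fixes U V :: "complex^'n^'n"
  assumes U: "unitary U" and V: "unitary V"
    and eq: "U ** diag_mat (\<lambda>i. of_real (d i)) ** ctranspose U
           = V ** diag_mat (\<lambda>i. of_real (e i)) ** ctranspose V"
  shows "U ** diag_mat (\<lambda>i. of_real (f (d i))) ** ctranspose U
       = V ** diag_mat (\<lambda>i. of_real (f (e i))) ** ctranspose V"
proof -
  let ?D = "\<lambda>d. diag_mat (\<lambda>i. complex_of_real (d i)) :: complex^'n^'n"
  define W where "W = ctranspose V ** U"
  have U1: "ctranspose U ** U = mat 1" and V1: "ctranspose V ** V = mat 1"
    using U V by (auto simp: unitary_def)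
  have U2: "U ** ctranspose U = mat 1" and V2: "V ** ctranspose V = mat 1"
    using U1 V1 matrix_left_right_inverse by blast+
  have "W ** ?D d = ctranspose V ** (U ** ?D d ** ctranspose U) ** U"
    unfolding W_def by (simp add: U1 flip: matrix_mul_assoc)
  also have "\<dots> = (ctranspose V ** V) ** ?D e ** (ctranspose V ** U)"
    unfolding eq by (simp add: matrix_mul_assoc)
  finally have "W ** ?D d = ?D e ** W"
    by (simp add: V1 W_def)
  hence "W $ i $ j * of_real (d j) = of_real (e i) * W $ i $ j" for i j
    by (metis diag_mat_mult_left diag_mat_mult_right)
  hence "W $ i $ j * of_real (f (d j)) = of_real (f (e i)) * W $ i $ j" for i j
    by (metis mult.commute mult_cancel_left of_real_eq_iff)
  hence *: "W ** ?D (\<lambda>i. f (d i)) = ?D (\<lambda>i. f (e i)) ** W"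
    by (simp add: vec_eq_iff diag_mat_mult_left diag_mat_mult_right)
  have "U ** ?D (\<lambda>i. f (d i)) ** ctranspose U
      = (V ** ctranspose V) ** U ** ?D (\<lambda>i. f (d i)) ** ctranspose U"
    by (simp add: V2)
  also have "\<dots> = V ** (W ** ?D (\<lambda>i. f (d i))) ** ctranspose U"
    by (simp add: W_def matrix_mul_assoc)
  also have "\<dots> = V ** ?D (\<lambda>i. f (e i)) ** ctranspose V ** (U ** ctranspose U)"
    unfolding * by (simp add: W_def matrix_mul_assoc)
  finally show ?thesis by (simp add: U2)
qed

lemma spectral_fun_eqI:
  fixes U :: "complex^'n^'n"
  assumes "unitary U" and "A = U ** diag_mat (\<lambda>i. of_real (d i)) ** ctranspose U"
  shows "spectral_fun f A = U ** diag_mat (\<lambda>i. of_real (f (d i))) ** ctranspose U"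
  unfolding spectral_fun_def
proof (rule the_equality, goal_cases)
  case 1
  show ?case using assms by blast
next
  case (2 B)
  then show ?case using assms spectral_fun_unique[of U _ d _ f] by metis
qed

lemma charpoly_degree_monic:
  fixes A :: "'a::idom^'n^'n"
  shows "degree (charpoly A) = CARD('n)" "lead_coeff (charpoly A) = 1"
proof -
  let ?M = "mat [:0, 1:] - map_matrix (\<lambda>a. [:a:]) A"
  let ?t = "\<lambda>p. of_int (sign p) * (\<Prod>i\<in>UNIV. ?M $ i $ p i)"
  let ?P = "{p. p permutes (UNIV :: 'n set)}"
  have fin: "finite ?P" by (simp add: finite_permutations)
  have diag: "?M $ i $ i = [:- (A $ i $ i), 1:]" for i by (simp add: mat_def)
  have offd: "i \<noteq> j \<Longrightarrow> degree (?M $ i $ j) = 0" for i j by (simp add: mat_def)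
  have id_in: "id \<in> ?P" by (simp add: permutes_id)
  have tid: "?t id = (\<Prod>i\<in>UNIV. [:- (A $ i $ i), 1:])"
    by (simp add: diag del: vector_minus_component)
  have did: "degree (?t id) = CARD('n)"
    unfolding tid by (subst degree_prod_eq_sum_degree) auto
  have mid: "coeff (?t id) (CARD('n)) = 1"
    using did lead_coeff_prod[of "\<lambda>i. [:- (A $ i $ i), 1:]" UNIV] unfolding tid by simp
  have small: "coeff (?t p) m = 0" if "p \<in> ?P - {id}" "m \<ge> CARD('n)" for p m
  proof -
    obtain j where j: "p j \<noteq> j" using \<open>p \<in> ?P - {id}\<close> by (auto simp: fun_eq_iff)
    have "degree (\<Prod>i\<in>UNIV. ?M $ i $ p i) \<le> (\<Sum>i\<in>UNIV. degree (?M $ i $ p i))"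
      using degree_prod_sum_le[of UNIV "\<lambda>i. ?M $ i $ p i"] by (simp add: o_def)
    also have "\<dots> < (\<Sum>i\<in>(UNIV::'n set). 1)"
    proof (rule sum_strict_mono_ex1)
      show "\<forall>i\<in>UNIV. degree (?M $ i $ p i) \<le> 1"
      proof
        fix i
        show "degree (?M $ i $ p i) \<le> 1"
          by (cases "p i = i") (simp_all add: diag offd del: vector_minus_component)
      qed
      show "\<exists>i\<in>UNIV. degree (?M $ i $ p i) < 1"
        using j offd[of j "p j"] by (intro bexI[of _ j]) auto
    qed auto
    finally have "coeff (\<Prod>i\<in>UNIV. ?M $ i $ p i) m = 0"
      using that by (intro coeff_eq_0) simp
    thus ?thesis by (simp add: sign_def)
  qed
  have c: "coeff (charpoly A) m = coeff (?t id) m" if "m \<ge> CARD('n)" for m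
    unfolding charpoly_def det_def using small that
    by (simp add: coeff_sum sum.remove[OF fin id_in])
  have "coeff (charpoly A) (CARD('n)) = 1" using c mid by simp
  moreover have "coeff (charpoly A) m = 0" if "m > CARD('n)" for m
    using c[of m] that did by (simp add: coeff_eq_0)
  ultimately show "degree (charpoly A) = CARD('n)"
    by (metis le_degree degree_le le_antisym one_neq_zero)
  thus "lead_coeff (charpoly A) = 1" using c mid by simp
qed

lemma charpoly_eigenvals:
  fixes A :: "complex^'n^'n"
  shows "charpoly A = (\<Prod>i\<in>UNIV. [:- eigenvals A i, 1:])"
proof -
  let ?n = "CARD('n)"
  obtain xs where xs: "mset xs = proots (charpoly A)" using ex_mset by blast
  have len: "length xs = ?n"
    by (metis xs size_mset size_proots_complex charpoly_degree_monic(1))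
  obtain h where h: "bij_betw h (UNIV::'n set) {..<?n}"
    by (metis ex_bij_betw_finite_nat finite atLeast0LessThan)
  have "charpoly A = (\<Prod>x\<in>#proots (charpoly A). [:- x, 1:])"
    using complex_poly_decompose_multiset[of "charpoly A"] charpoly_degree_monic(2)[of A] by simp
  also have "\<dots> = prod_list (map (\<lambda>x. [:- x, 1:]) xs)"
    unfolding xs[symmetric] by (metis mset_map prod_mset_prod_list)
  also have "\<dots> = (\<Prod>k<?n. [:- (xs ! k), 1:])"
    by (simp add: prod.list_conv_set_nth len atLeast0LessThan)
  also have "\<dots> = (\<Prod>i\<in>UNIV. [:- (xs ! h i), 1:])"
    by (rule prod.reindex_bij_betw[OF h, symmetric])
  finally have "\<exists>d :: 'n \<Rightarrow> complex. charpoly A = (\<Prod>i\<in>UNIV. [:- d i, 1:])"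
    by (intro exI[of _ "\<lambda>i. xs ! h i"])
  thus ?thesis unfolding eigenvals_def by (rule someI_ex)
qed

end

theory Submission
  imports Defs "HOL-Complex_Analysis.Conformal_Mappings"
begin

text \<open>Write \<open>Tr\<^sub>k\<close> for the trace of the \<open>k\<close>-th exterior power, and let \<open>C = a A + b B\<close> with \<open>a + b = 1\<close>.
  For \<open>s \<le> 1\<close> the claim follows from the operator concavity and monotonicity of \<open>t \<mapsto> t\<^sup>r\<close> and
  \<open>t \<mapsto> t\<^sup>s\<close> together with the concavity and monotonicity of \<open>\<phi>\<close>.

  For \<open>s \<ge> 1\<close> put \<open>q = r s \<le> 1\<close> and \<open>N = C\<^bsup>r/2\<^esup> K\<close>. The function
  \<open>G\<^sub>A(z) = A\<^bsup>q z/2\<^esup> C\<^bsup>- q z/2\<^esup> N |N|\<^bsup>s z - 1\<^esup>\<close> is a contraction on \<open>Re z = 0\<close>, equals \<open>A\<^bsup>r/2\<^esup> K\<close> at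
  \<open>z = 1/s\<close>, and on \<open>Re z = 1\<close> the matrix \<open>G\<^sub>A* G\<^sub>A\<close> is a congruence of \<open>A\<^sup>q\<close>; operator concavity of
  \<open>t \<mapsto> t\<^sup>q\<close> gives \<open>a G\<^sub>A* G\<^sub>A + b G\<^sub>B* G\<^sub>B \<le> |N|\<^bsup>2 s\<^esup>\<close> up to a unitary conjugation. Pairing \<open>G\<^sub>A\<close>
  with a dual analytic family under \<open>Tr\<^sub>k\<close> yields scalar functions \<open>h\<^sub>A\<close> and \<open>h\<^sub>B\<close>. The three lines
  theorem for all products \<open>h\<^sub>A\<^sup>m h\<^sub>B\<^sup>n\<close>, with \<open>m/(m + n)\<close> tending to the optimal weight in the
  arithmetic-geometric mean inequality, gives the additive inequality for \<open>\<phi>\<close>.\<close>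

subsection \<open>The Hermitian inner product\<close>

text \<open>For s > 1 the map t -> t^s is in general neither operator concave nor operator monotone,
  so the comparison of the matrices \<open>(K* A^r K)^s\<close> has to take place under
  \<open>Tr_k\<close>. For k = 1 the pairings h_A and h_B could simply be added. For k > 1 only the
  k-th root of \<open>Tr_k\<close> is superadditive, and a k-th root of a pairing need not be
  holomorphic. Products of powers are holomorphic, and they suffice because the additive bound on Re
  z = 1 has the same right-hand side at every point of that line.

  The dual family is built so that the number E_A which h_A takes at z = 1/s is also its bound on Re
  z = 0 and a factor of its Cauchy-Schwarz bound on Re z = 1; the estimate thus improves itself
  until E_A cancels.

  Singular matrices need no perturbation: A is dominated by a multiple of C, hence vanishes on the
  kernel of C, and there negative powers of C act as genuine inverses. The comparison steps are
  stated for any R dominating a P + b Q, so that concavity and monotonicity travel together.\<close>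

definition cinner :: "complex^'n \<Rightarrow> complex^'n \<Rightarrow> complex" where
  "cinner v w = (\<Sum>i\<in>UNIV. cnj (v $ i) * w $ i)"

lemma cinner_add_left: "cinner (u + v) w = cinner u w + cinner v w"
  by (simp add: cinner_def sum.distrib distrib_right)

lemma cinner_add_right: "cinner w (u + v) = cinner w u + cinner w v"
  by (simp add: cinner_def sum.distrib distrib_left)

lemma cinner_diff_right: "cinner w (u - v) = cinner w u - cinner w v"
  by (simp add: cinner_def sum_subtractf right_diff_distrib)

lemma cinner_scale_left: "cinner (c *s v) w = cnj c * cinner v w"
  by (simp add: cinner_def sum_distrib_left mult.assoc)

lemma cinner_scale_right: "cinner v (c *s w) = c * cinner v w"
  by (simp add: cinner_def sum_distrib_left mult_ac)

lemma cnj_cinner: "cnj (cinner v w) = cinner w v"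
  by (simp add: cinner_def mult.commute)

lemma Re_cinner: "Re (cinner v w) = v \<bullet> w"
  by (simp add: cinner_def inner_vec_def inner_complex_def)

lemma cinner_self: "cinner v v = of_real ((norm v)\<^sup>2)"
proof -
  have "Im (cinner v v) = 0"
    using cnj_cinner[of v v] by (metis Reals_cnj_iff complex_is_Real_iff)
  thus ?thesis
    using Re_cinner[of v v] by (simp add: complex_eq_iff dot_square_norm)
qed

lemma norm_scale_vec: "norm (c *s v) = norm c * norm v" for v :: "complex^'n"
proof -
  have "complex_of_real ((norm (c *s v))\<^sup>2) = cnj c * (c * cinner v v)"
    unfolding cinner_self[symmetric] by (simp add: cinner_scale_left cinner_scale_right)
  also have "\<dots> = of_real ((norm c * norm v)\<^sup>2)"
    using complex_norm_square[of c] by (simp add: cinner_self power_mult_distrib mult_ac)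
  finally have "(norm (c *s v))\<^sup>2 = (norm c * norm v)\<^sup>2"
    unfolding of_real_eq_iff .
  thus ?thesis by (simp add: power2_eq_iff_nonneg)
qed

text \<open>Rescaling \<open>v\<close> by the value \<open>cinner v w\<close> itself removes the
  phase, so the real Cauchy-Schwarz inequality suffices.\<close>

lemma norm_cinner_le: "norm (cinner v w) \<le> norm v * norm w"
proof (cases "cinner v w = 0")
  case False
  let ?c = "cinner v w"
  have "(norm ?c)\<^sup>2 = Re (cinner (?c *s v) w)"
    by (simp add: cinner_scale_left cmod_power2 power2_eq_square[of "Re _"] power2_eq_square[of "Im _"])
  also have "\<dots> \<le> norm (?c *s v) * norm w"
    unfolding Re_cinner by (rule norm_cauchy_schwarz)
  also have "\<dots> = norm ?c * (norm v * norm w)" by (simp add: norm_scale_vec)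
  finally show ?thesis using False by (simp add: power2_eq_square)
qed simp

section \<open>Adjoints, quadratic forms and the positive semidefinite cone\<close>

lemma ctranspose_mult: "ctranspose (A ** B) = ctranspose B ** ctranspose A"
  by (simp add: ctranspose_def matrix_matrix_mult_def transpose_def map_matrix_def vec_eq_iff mult.commute)

lemma ctranspose_ctranspose [simp]: "ctranspose (ctranspose A) = A"
  by (simp add: ctranspose_def transpose_def map_matrix_def vec_eq_iff)

lemma ctranspose_nth: "ctranspose A $ i $ j = cnj (A $ j $ i)"
  by (simp add: ctranspose_def transpose_def map_matrix_def)

lemma ctranspose_add: "ctranspose (A + B) = ctranspose A + ctranspose B"
  by (simp add: vec_eq_iff ctranspose_nth)

lemma ctranspose_scaleR: "ctranspose (c *\<^sub>R A) = c *\<^sub>R ctranspose A"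
  by (simp add: vec_eq_iff ctranspose_nth)

lemma ctranspose_diag_mat: "ctranspose (diag_mat d) = diag_mat (\<lambda>i. cnj (d i))"
  by (auto simp: vec_eq_iff ctranspose_nth diag_mat_def)

lemma cinner_adjoint: "cinner v (A *v w) = cinner (ctranspose A *v v) w"
proof -
  have "cinner v (A *v w) = (\<Sum>i\<in>UNIV. \<Sum>j\<in>UNIV. cnj (v $ i) * A $ i $ j * w $ j)"
    by (simp add: cinner_def matrix_vector_mult_def sum_distrib_left mult.assoc)
  also have "\<dots> = (\<Sum>j\<in>UNIV. \<Sum>i\<in>UNIV. cnj (v $ i) * A $ i $ j * w $ j)"
    by (rule sum.swap)
  also have "\<dots> = cinner (ctranspose A *v v) w"
    by (simp add: cinner_def matrix_vector_mult_def sum_distrib_right ctranspose_nth)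
       (simp add: mult_ac)
  finally show ?thesis .
qed

lemma quad_form_eq: "quad_form A v = cinner v (A *v v)"
  by (simp add: quad_form_def cinner_def matrix_vector_mult_def sum_distrib_left mult.assoc)

lemma matrix_scaleR_vec: "(c *\<^sub>R A) *v v = c *\<^sub>R (A *v v)" for A :: "complex^'n^'n"
  by (simp add: matrix_vector_mult_def vec_eq_iff scaleR_sum_right)

lemma matrix_vec_scale: "A *v (c *s v) = c *s (A *v v)" for A :: "complex^'n^'n"
  by (simp add: matrix_vector_mult_def vec_eq_iff sum_distrib_left mult_ac)

text \<open>Pointwise inequalities between these forms serve as the Loewner order
  throughout.\<close>

definition qf :: "complex^'n^'n \<Rightarrow> complex^'n \<Rightarrow> real" where
  "qf A v = Re (quad_form A v)"

lemma qf_add: "qf (A + B) v = qf A v + qf B v"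
  by (simp add: qf_def quad_form_eq matrix_vector_mult_add_rdistrib cinner_add_right)

lemma qf_scaleR: "qf (c *\<^sub>R A) v = c * qf A v"
  by (simp add: qf_def quad_form_eq matrix_scaleR_vec Re_cinner)

lemma qf_congruence: "qf (ctranspose M ** P ** M) v = qf P (M *v v)"
  by (simp add: qf_def quad_form_eq cinner_adjoint flip: matrix_vector_mul_assoc)

lemma qf_gram: "qf (ctranspose M ** M) v = (norm (M *v v))\<^sup>2"
  using qf_congruence[of M "mat 1" v]
  by (simp add: qf_def quad_form_eq Re_cinner dot_square_norm)

lemma psd_coneI: "hermitian A \<Longrightarrow> (\<And>v. 0 \<le> qf A v) \<Longrightarrow> A \<in> psd_cone"
  by (simp add: psd_cone_def qf_def)

lemma psd_cone_hermitian: "A \<in> psd_cone \<Longrightarrow> ctranspose A = A"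
  by (simp add: psd_cone_def hermitian_def)

lemma psd_cone_qf: "A \<in> psd_cone \<Longrightarrow> 0 \<le> qf A v"
  by (simp add: psd_cone_def qf_def)

lemma psd_cone_congruence: "P \<in> psd_cone \<Longrightarrow> ctranspose M ** P ** M \<in> psd_cone"
  by (intro psd_coneI)
    (simp_all add: hermitian_def ctranspose_mult matrix_mul_assoc psd_cone_hermitian
      qf_congruence psd_cone_qf)

lemma psd_cone_gram: "ctranspose M ** M \<in> psd_cone"
  by (intro psd_coneI) (simp_all add: hermitian_def ctranspose_mult qf_gram)

lemma psd_cone_combine:
  assumes "A \<in> psd_cone" "B \<in> psd_cone" "0 \<le> a" "0 \<le> b"
  shows "a *\<^sub>R A + b *\<^sub>R B \<in> psd_cone"
  using assms
  by (intro psd_coneI)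
    (simp_all add: hermitian_def ctranspose_add ctranspose_scaleR psd_cone_hermitian
      qf_add qf_scaleR psd_cone_qf)


subsection \<open>The spectral theorem\<close>

lemma hermitian_cinner: "ctranspose A = A \<Longrightarrow> cinner v (A *v w) = cinner (A *v v) w"
  by (simp add: cinner_adjoint)

text \<open>An index outside \<open>J\<close> leaves one coordinate of \<open>f\<close> identically
  zero, so this endomorphism is not onto and therefore has a kernel.\<close>

lemma ex_nonzero_orthogonal:
  fixes v :: "'n::finite \<Rightarrow> complex^'n"
  assumes "J \<noteq> UNIV"
  shows "\<exists>w. w \<noteq> 0 \<and> (\<forall>j\<in>J. cinner (v j) w = 0)"
proof -
  define f where "f x = (\<chi> j. if j \<in> J then cinner (v j) x else 0)" for x
  have lin: "linear f"
  proof (rule linearI)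
    show "f (x + y) = f x + f y" for x y
      by (simp add: f_def vec_eq_iff cinner_add_right)
    show "f (r *\<^sub>R x) = r *\<^sub>R f x" for r x
      by (simp add: f_def vec_eq_iff cinner_def scaleR_sum_right)
  qed
  obtain j where "j \<notin> J" using assms by blast
  hence "f x \<noteq> (\<chi> i. 1)" for x by (auto simp: f_def vec_eq_iff)
  hence "\<not> surj f" by (metis surjD)
  hence "\<not> inj f" using linear_injective_imp_surjective[OF lin] by blast
  then obtain w where "w \<noteq> 0" "f w = 0"
    using linear_injective_0[OF lin] by blast
  moreover have "cinner (v j) w = 0" if "j \<in> J" for j
    using \<open>f w = 0\<close> that unfolding f_def vec_eq_iff by (auto dest: spec[of _ j])
  ultimately show ?thesis by blast
qed

text \<open>The eigenvector maximises the quadratic form on the unit sphere of \<open>W\<close>: with \<open>l\<close> the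
  maximum, \<open>l - A\<close> is a semidefinite form on \<open>W\<close> vanishing at the maximiser.\<close>

lemma ex_eigenvector_invariant:
  fixes A :: "complex^'n^'n"
  assumes A: "ctranspose A = A"
    and W: "W = {w. \<forall>j\<in>J. cinner (v j) w = 0}"
    and inv: "\<And>w. w \<in> W \<Longrightarrow> A *v w \<in> W"
    and ne: "\<exists>w\<in>W. w \<noteq> 0"
  shows "\<exists>w\<in>W. norm w = 1 \<and> (\<exists>l. A *v w = of_real l *s w)"
proof -
  have comb: "x + c *s y \<in> W" if "x \<in> W" "y \<in> W" for x y c
    using that by (simp add: W cinner_add_right cinner_scale_right)
  have scale: "c *s y \<in> W" if "y \<in> W" for y c
    using that by (simp add: W cinner_scale_right)
  have scaleR_s: "r *\<^sub>R x = of_real r *s x" for r and x :: "complex^'n"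
    by (simp add: vec_eq_iff complex_eq_iff)
  have cont: "continuous_on UNIV (\<lambda>w. cinner x w)" for x :: "complex^'n"
    unfolding cinner_def by (intro continuous_intros)
  have "closed W"
    unfolding W Collect_ball_eq by (intro closed_INT ballI closed_Collect_eq cont continuous_intros)
  hence comp: "compact (W \<inter> sphere 0 1)" by (intro closed_Int_compact compact_sphere)
  obtain w0 where w0: "w0 \<in> W" "w0 \<noteq> 0" using ne by blast
  have "of_real (1 / norm w0) *s w0 \<in> W \<inter> sphere 0 1"
    using w0 scale by (simp add: norm_scale_vec norm_divide)
  hence nonempty: "W \<inter> sphere 0 1 \<noteq> {}" by blast
  have contqf: "continuous_on (W \<inter> sphere 0 1) (qf A)"
    unfolding qf_def quad_form_def by (intro continuous_intros)
  obtain w where w: "w \<in> W" "norm w = 1" and max: "\<And>y. y \<in> W \<inter> sphere 0 1 \<Longrightarrow> qf A y \<le> qf A w"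
    using continuous_attains_sup[OF comp nonempty contqf] by auto
  define l where "l = qf A w"
  have bound: "qf A y \<le> l * (norm y)\<^sup>2" if "y \<in> W" for y
  proof (cases "y = 0")
    case True
    thus ?thesis by (simp add: qf_def quad_form_eq cinner_def)
  next
    case False
    let ?c = "1 / norm y"
    have "of_real ?c *s y \<in> W \<inter> sphere 0 1"
      using False that scale by (simp add: norm_scale_vec norm_divide)
    hence "qf A (of_real ?c *s y) \<le> l" unfolding l_def by (rule max)
    moreover have "qf A (of_real ?c *s y) = ?c\<^sup>2 * qf A y"
      by (simp add: qf_def quad_form_eq matrix_vec_scale cinner_scale_left cinner_scale_right
          power2_eq_square)
    ultimately have "?c\<^sup>2 * qf A y \<le> l" by simp
    thus ?thesis using False by (simp add: field_simps)
  qed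
  define u where "u = A *v w - of_real l *s w"
  have uW: "u \<in> W"
    using inv[OF w(1)] w(1) by (auto simp: u_def W cinner_diff_right cinner_scale_right)
  \<comment> \<open>The maximiser is perturbed along its residual \<open>u\<close>; the first-order
    gain 2 t |u|^2 cannot be compensated for small t unless u = 0.\<close>
  have quad: "0 \<le> t\<^sup>2 * (l * (norm u)\<^sup>2 - qf A u) - 2 * t * (norm u)\<^sup>2" for t :: real
  proof -
    let ?y = "w + of_real t *s u"
    have b: "qf A ?y \<le> l * (norm ?y)\<^sup>2" using comb w uW by (intro bound) blast
    have n: "(norm ?y)\<^sup>2 = 1 + 2 * t * Re (cinner u w) + t\<^sup>2 * (norm u)\<^sup>2"
    proof -
      have "(norm ?y)\<^sup>2 = Re (cinner ?y ?y)" by (simp add: cinner_self del: of_real_power)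
      also have "\<dots> = 1 + 2 * t * Re (cinner u w) + t\<^sup>2 * (norm u)\<^sup>2"
        unfolding cinner_add_left cinner_add_right cinner_scale_left cinner_scale_right
        using w(2)
        by (simp add: cinner_self Re_cinner inner_commute power2_eq_square algebra_simps)
      finally show ?thesis .
    qed
    have "cinner w (A *v u) = cnj (cinner u (A *v w))"
      by (simp add: hermitian_cinner[OF A] cnj_cinner)
    hence m: "qf A ?y = l + 2 * t * Re (cinner u (A *v w)) + t\<^sup>2 * qf A u"
      by (simp add: l_def qf_def quad_form_eq matrix_vector_right_distrib matrix_vec_scale
          cinner_add_left cinner_add_right cinner_scale_left cinner_scale_right
          power2_eq_square algebra_simps)
    have "Re (cinner u (A *v w)) = (norm u)\<^sup>2 + l * Re (cinner u w)"
    proof -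
      have "A *v w = u + of_real l *s w" by (simp add: u_def)
      hence "cinner u (A *v w) = cinner u u + of_real l * cinner u w"
        by (simp only: cinner_add_right cinner_scale_right)
      thus ?thesis by (simp add: cinner_self del: of_real_power)
    qed
    thus ?thesis using b unfolding n m by (simp add: algebra_simps)
  qed
  have "u = 0"
  proof (rule ccontr)
    assume "u \<noteq> 0"
    define c where "c = l * (norm u)\<^sup>2 - qf A u"
    have c: "c \<ge> 0" using bound[OF uW] by (simp add: c_def)
    \<comment> \<open>The summand 1 keeps the denominator positive and gives t c \<le>
      |u|^2.\<close>
    define t where "t = (norm u)\<^sup>2 / (c + 1)"
    have t: "t > 0" using c \<open>u \<noteq> 0\<close> by (simp add: t_def)
    have "t * (2 * (norm u)\<^sup>2) \<le> t * (t * c)"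
      using quad[of t] by (simp add: c_def power2_eq_square algebra_simps)
    hence "2 * (norm u)\<^sup>2 \<le> t * c" using t by simp
    also have "\<dots> \<le> (norm u)\<^sup>2"
      using c unfolding t_def by (simp add: field_simps)
    finally show False using \<open>u \<noteq> 0\<close> by simp
  qed
  hence "A *v w = of_real l *s w" by (simp add: u_def)
  thus ?thesis using w by blast
qed

text \<open>The matrix size is fixed by the type, so the induction runs over a set of column
  indices: the orthogonal complement of the eigenvectors already found is invariant because
  \<open>A\<close> is Hermitian.\<close>

theorem hermitian_diagonalization:
  fixes A :: "complex^'n^'n"
  assumes A: "ctranspose A = A"
  shows "\<exists>U d. unitary U \<and> A = U ** diag_mat (\<lambda>i. of_real (d i)) ** ctranspose U"
proof -
  have "\<exists>v d. (\<forall>i\<in>J. \<forall>j\<in>J. cinner (v i) (v j) = (if i = j then 1 else 0))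
      \<and> (\<forall>i\<in>J. A *v v i = of_real (d i) *s v i)" for J :: "'n set"
  proof (induction J rule: finite_induct[OF finite])
    case 1
    show ?case by simp
  next
    case (2 k J)
    then obtain v d where o: "\<And>i j. i \<in> J \<Longrightarrow> j \<in> J \<Longrightarrow> cinner (v i) (v j) = (if i = j then 1 else 0)"
      and e: "\<And>i. i \<in> J \<Longrightarrow> A *v v i = of_real (d i) *s v i" by blast
    define W where "W = {w. \<forall>j\<in>J. cinner (v j) w = 0}"
    have "A *v w \<in> W" if "w \<in> W" for w
      using that by (simp add: W_def hermitian_cinner[OF A] e cinner_scale_left)
    moreover have "\<exists>w\<in>W. w \<noteq> 0"
      using ex_nonzero_orthogonal[of J v] 2(2) unfolding W_def by blast
    ultimately obtain w l where w: "w \<in> W" "norm w = 1" "A *v w = of_real l *s w"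
      using ex_eigenvector_invariant[OF A W_def] by blast
    have z: "cinner (v j) w = 0" if "j \<in> J" for j using w(1) that by (simp add: W_def)
    have z': "cinner w (v j) = 0" if "j \<in> J" for j using z[OF that] cnj_cinner[of "v j" w] by simp
    have "cinner w w = 1" using w(2) by (simp add: cinner_self)
    with 2(2) show ?case
      by (intro exI[of _ "v(k := w)"] exI[of _ "d(k := l)"]) (auto simp: o e w(3) z z')
  qed
  from this[of UNIV] obtain v :: "'n \<Rightarrow> complex^'n" and d where
    o: "\<And>i j. cinner (v i) (v j) = (if i = j then 1 else 0)"
    and e: "\<And>i. A *v v i = of_real (d i) *s v i" by (simp, blast)
  define U :: "complex^'n^'n" where "U = (\<chi> i j. v j $ i)"
  have U: "unitary U"
    using o by (simp add: unitary_def vec_eq_iff matrix_matrix_mult_def ctranspose_nth mat_def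
        U_def cinner_def)
  have "A ** U = U ** diag_mat (\<lambda>i. of_real (d i))"
    using e by (simp add: vec_eq_iff diag_mat_mult_right)
      (simp add: matrix_matrix_mult_def U_def matrix_vector_mult_def mult.commute)
  hence "U ** diag_mat (\<lambda>i. of_real (d i)) ** ctranspose U = A ** (U ** ctranspose U)"
    by (simp add: matrix_mul_assoc)
  moreover have "U ** ctranspose U = mat 1"
    using U matrix_left_right_inverse unfolding unitary_def by blast
  ultimately have "A = U ** diag_mat (\<lambda>i. of_real (d i)) ** ctranspose U" by simp
  thus ?thesis using U by blast
qed

subsection \<open>The three lines theorem for scalar and matrix functions\<close>

definition strip :: "complex set" where
  "strip = {z. 0 \<le> Re z \<and> Re z \<le> 1}"

text \<open>All functions needed are entire, which avoids questions of boundary regularity;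
  boundedness on the strip is the growth condition of the three lines theorem.\<close>

definition strip_bounded :: "(complex \<Rightarrow> complex) \<Rightarrow> bool" where
  "strip_bounded f \<longleftrightarrow> f holomorphic_on UNIV \<and> (\<exists>B. \<forall>z\<in>strip. norm (f z) \<le> B)"

lemma strip_bounded_const: "strip_bounded (\<lambda>z. c)"
  by (auto simp: strip_bounded_def)

lemma strip_bounded_add:
  assumes "strip_bounded f" "strip_bounded g"
  shows "strip_bounded (\<lambda>z. f z + g z)"
proof -
  obtain B C where "\<forall>z\<in>strip. norm (f z) \<le> B" "\<forall>z\<in>strip. norm (g z) \<le> C"
    using assms by (auto simp: strip_bounded_def)
  hence "\<forall>z\<in>strip. norm (f z + g z) \<le> B + C"
    by (intro ballI norm_triangle_le add_mono) auto
  thus ?thesis using assms unfolding strip_bounded_def by (blast intro: holomorphic_intros)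
qed

lemma strip_bounded_mult:
  assumes "strip_bounded f" "strip_bounded g"
  shows "strip_bounded (\<lambda>z. f z * g z)"
proof -
  obtain B C where "\<forall>z\<in>strip. norm (f z) \<le> B" "\<forall>z\<in>strip. norm (g z) \<le> C"
    using assms by (auto simp: strip_bounded_def)
  hence "norm (f z * g z) \<le> B * C" if "z \<in> strip" for z
    unfolding norm_mult using that order_trans[OF norm_ge_zero[of "f z"]] by (intro mult_mono) auto
  thus ?thesis using assms unfolding strip_bounded_def by (blast intro: holomorphic_intros)
qed

lemma strip_bounded_sum:
  assumes "\<And>i. i \<in> I \<Longrightarrow> strip_bounded (f i)"
  shows "strip_bounded (\<lambda>z. \<Sum>i\<in>I. f i z)"
  using assms by (induction I rule: infinite_finite_induct)
    (simp_all add: strip_bounded_const strip_bounded_add)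

lemma strip_bounded_prod:
  assumes "\<And>i. i \<in> I \<Longrightarrow> strip_bounded (f i)"
  shows "strip_bounded (\<lambda>z. \<Prod>i\<in>I. f i z)"
  using assms by (induction I rule: infinite_finite_induct)
    (simp_all add: strip_bounded_const strip_bounded_mult)

lemma strip_bounded_power: "strip_bounded f \<Longrightarrow> strip_bounded (\<lambda>z. f z ^ m)"
  by (induction m) (simp_all add: strip_bounded_const strip_bounded_mult)

text \<open>Serves for powers of a positive eigenvalue (c its logarithm) and for the factor that
  equalises the two edge bounds in \<open>three_lines_product\<close>.\<close>

lemma strip_bounded_exp_affine: "strip_bounded (\<lambda>z. exp ((of_real a * z + of_real b) * of_real c))"
proof -
  have "norm (exp ((of_real a * z + of_real b) * of_real c)) \<le> exp ((\<bar>a\<bar> + \<bar>b\<bar>) * \<bar>c\<bar>)"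
    if "z \<in> strip" for z
  proof -
    have "Re ((of_real a * z + of_real b) * of_real c) \<le> \<bar>(a * Re z + b) * c\<bar>" by simp
    also have "\<dots> \<le> (\<bar>a\<bar> * 1 + \<bar>b\<bar>) * \<bar>c\<bar>"
      using that unfolding abs_mult strip_def
      by (intro mult_right_mono order_trans[OF abs_triangle_ineq] add_mono)
        (auto simp: abs_mult mult_left_le)
    finally show ?thesis by simp
  qed
  thus ?thesis unfolding strip_bounded_def
    by (intro conjI exI[of _ "exp ((\<bar>a\<bar> + \<bar>b\<bar>) * \<bar>c\<bar>)"] ballI holomorphic_intros)
qed

text \<open>Multiplying by \<open>exp (e * (z\<^sup>2 - 1))\<close>, which is at most 1 in modulus on the strip and tends to 0
  at its ends, reduces the claim to the maximum principle on a rectangle.\<close>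

lemma strip_maximum_principle:
  assumes f: "strip_bounded f"
    and edge: "\<And>z. Re z = 0 \<or> Re z = 1 \<Longrightarrow> norm (f z) \<le> M"
    and w: "w \<in> strip"
  shows "norm (f w) \<le> M"
proof -
  obtain B where B: "\<And>z. z \<in> strip \<Longrightarrow> norm (f z) \<le> B" and hol: "f holomorphic_on UNIV"
    using f by (auto simp: strip_bounded_def)
  have M: "0 \<le> M" using order_trans[OF norm_ge_zero edge[of 0]] by simp
  have step: "norm (f w) * exp (e * (Re (w\<^sup>2) - 1)) \<le> M" if e: "e > 0" for e
  proof -
    define g where "g z = f z * exp (of_real e * (z\<^sup>2 - 1))" for z
    have ng: "norm (g z) = norm (f z) * exp (e * ((Re z)\<^sup>2 - (Im z)\<^sup>2 - 1))" for z
      by (simp add: g_def norm_mult power2_eq_square)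
    have ng1: "norm (g z) \<le> norm (f z) * exp (- (e * (Im z)\<^sup>2))" if "z \<in> strip" for z
    proof -
      have "(Re z)\<^sup>2 \<le> 1" using that by (auto simp: strip_def power_le_one)
      hence "e * ((Re z)\<^sup>2 - (Im z)\<^sup>2 - 1) \<le> e * (- (Im z)\<^sup>2)" using e by (intro mult_left_mono) auto
      thus ?thesis unfolding ng by (intro mult_left_mono) auto
    qed
    have "((\<lambda>y::real. \<bar>B\<bar> * exp (- (e * y\<^sup>2))) \<longlongrightarrow> 0) at_top"
    proof -
      have "filterlim (\<lambda>y::real. e * y\<^sup>2) at_top at_top"
        using e by (intro filterlim_tendsto_pos_mult_at_top[OF tendsto_const]
            filterlim_pow_at_top filterlim_ident) auto
      hence "filterlim (\<lambda>y::real. - (e * y\<^sup>2)) at_bot at_top"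
        by (simp add: filterlim_uminus_at_top)
      hence "((\<lambda>y::real. exp (- (e * y\<^sup>2))) \<longlongrightarrow> 0) at_top"
        using exp_at_bot filterlim_compose by blast
      thus ?thesis by (rule tendsto_mult_right_zero)
    qed
    show ?thesis
    \<comment> \<open>Pushing the horizontal sides of the rectangle below \<open>M\<close> is
      possible only for a positive \<open>M\<close>.\<close>
    proof (cases "M = 0")
      case False
      with M have "M > 0" by simp
      hence "eventually (\<lambda>y. \<bar>B\<bar> * exp (- (e * y\<^sup>2)) < M) at_top"
        using \<open>((\<lambda>y. \<bar>B\<bar> * exp (- (e * y\<^sup>2))) \<longlongrightarrow> 0) at_top\<close> order_tendstoD(2) by blast
      then obtain Y0 where Y0: "\<And>y. y \<ge> Y0 \<Longrightarrow> \<bar>B\<bar> * exp (- (e * y\<^sup>2)) < M"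
        by (auto simp: eventually_at_top_linorder)
      define Y where "Y = max 1 (max Y0 (\<bar>Im w\<bar> + 1))"
      let ?S = "cbox (Complex 0 (- Y)) (Complex 1 Y)"
      have wS: "w \<in> ?S" using w by (auto simp: in_cbox_complex_iff strip_def Y_def)
      have "norm (g w) \<le> M"
      proof (rule maximum_modulus_frontier[of g ?S])
        have hg: "g holomorphic_on UNIV"
          unfolding g_def by (intro holomorphic_intros hol)
        show "g holomorphic_on interior ?S" using hg holomorphic_on_subset by blast
        show "continuous_on (closure ?S) g"
          using hg holomorphic_on_imp_continuous_on continuous_on_subset by blast
        show "bounded ?S" by (rule bounded_cbox)
        show "w \<in> ?S" by (rule wS)
        fix z assume "z \<in> frontier ?S"
        hence z: "z \<in> ?S" "z \<notin> box (Complex 0 (- Y)) (Complex 1 Y)"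
          by (auto simp: frontier_def interior_cbox)
        hence zs: "z \<in> strip" by (auto simp: in_cbox_complex_iff strip_def)
        have "Re z = 0 \<or> Re z = 1 \<or> \<bar>Im z\<bar> = Y"
          using z by (auto simp: in_cbox_complex_iff in_box_complex_iff)
        thus "norm (g z) \<le> M"
        proof (elim disjE)
          assume "\<bar>Im z\<bar> = Y"
          hence "(Im z)\<^sup>2 = Y\<^sup>2" by (metis power2_abs)
          have "norm (g z) \<le> norm (f z) * exp (- (e * Y\<^sup>2))"
            using ng1[OF zs] \<open>(Im z)\<^sup>2 = Y\<^sup>2\<close> by simp
          also have "\<dots> \<le> \<bar>B\<bar> * exp (- (e * Y\<^sup>2))"
            using B[OF zs] by (intro mult_right_mono) auto
          also have "\<dots> \<le> M" using Y0[of Y] by (simp add: Y_def less_imp_le)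
          finally show ?thesis .
        next
          assume "Re z = 0"
          hence "norm (f z) \<le> M" using edge by blast
          moreover have "norm (f z) * exp (- (e * (Im z)\<^sup>2)) \<le> norm (f z) * 1"
            using e by (intro mult_left_mono) auto
          ultimately show ?thesis using ng1[OF zs] by linarith
        next
          assume "Re z = 1"
          hence "norm (f z) \<le> M" using edge by blast
          moreover have "norm (f z) * exp (- (e * (Im z)\<^sup>2)) \<le> norm (f z) * 1"
            using e by (intro mult_left_mono) auto
          ultimately show ?thesis using ng1[OF zs] by linarith
        qed
      qed
      thus ?thesis by (simp add: ng power2_eq_square)
    next
      case True
      text \<open>If \<open>M = 0\<close> then \<open>f\<close> vanishes on the whole line \<open>Re z = 0\<close>, hence identically.\<close>
      have "f z = 0" for z
      proof (rule analytic_continuation[of f UNIV "{z. Re z = 0}" 0])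
        show "(0::complex) islimpt {z. Re z = 0}"
        proof (subst islimpt_approachable, intro allI impI)
          fix d :: real assume "d > 0"
          thus "\<exists>z\<in>{z. Re z = 0}. z \<noteq> 0 \<and> dist z 0 < d"
            by (intro bexI[of _ "Complex 0 (d / 2)"]) (auto simp: complex_norm complex_eq_iff)
        qed
        show "f z = 0" if "z \<in> {z. Re z = 0}" for z
          using edge[of z] that True by simp
      qed (use hol in auto)
      thus ?thesis using True by simp
    qed
  qed
  have "((\<lambda>e. norm (f w) * exp (e * (Re (w\<^sup>2) - 1))) \<longlongrightarrow> norm (f w) * exp (0 * (Re (w\<^sup>2) - 1))) (at_right 0)"
    by (intro tendsto_intros)
  moreover have "eventually (\<lambda>e. norm (f w) * exp (e * (Re (w\<^sup>2) - 1)) \<le> M) (at_right 0)"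
    using step by (auto simp: eventually_at_right_field intro!: exI[of _ 1])
  ultimately have "norm (f w) * exp (0 * (Re (w\<^sup>2) - 1)) \<le> M"
    by (rule tendsto_upperbound) simp
  thus ?thesis by simp
qed

definition strip_bounded_matrix :: "(complex \<Rightarrow> complex^'n^'n) \<Rightarrow> bool" where
  "strip_bounded_matrix F \<longleftrightarrow> (\<forall>i j. strip_bounded (\<lambda>z. F z $ i $ j))"

lemma strip_bounded_matrix_const: "strip_bounded_matrix (\<lambda>z. A)"
  by (simp add: strip_bounded_matrix_def strip_bounded_const)

lemma strip_bounded_matrix_mult:
  assumes "strip_bounded_matrix F" "strip_bounded_matrix G"
  shows "strip_bounded_matrix (\<lambda>z. F z ** G z)"
  using assms unfolding strip_bounded_matrix_def matrix_matrix_mult_def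
  by (auto intro!: strip_bounded_sum strip_bounded_mult)

lemma strip_bounded_cinner:
  assumes "strip_bounded_matrix F"
  shows "strip_bounded (\<lambda>z. cinner u (F z *v w))"
  using assms unfolding strip_bounded_matrix_def cinner_def matrix_vector_mult_def
  by (auto intro!: strip_bounded_sum strip_bounded_mult strip_bounded_const)


subsection \<open>Complex powers of positive semidefinite matrices\<close>

lemma diag_mat_mult: "diag_mat d ** diag_mat e = diag_mat (\<lambda>i. d i * e i :: complex)"
  unfolding vec_eq_iff diag_mat_mult_left by (simp add: diag_mat_def)

lemma diag_mat_mult_vec: "(diag_mat d *v w) $ i = d i * w $ i" for d :: "'n::finite \<Rightarrow> complex"
  by (simp add: diag_mat_def matrix_vector_mult_def if_distrib[of "\<lambda>x. x * _"] cong: if_cong)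

lemma unitary_right: "unitary U \<Longrightarrow> U ** ctranspose U = mat 1"
  unfolding unitary_def using matrix_left_right_inverse by blast

lemma unitary_conj_mult:
  assumes "unitary U"
  shows "(U ** D ** ctranspose U) ** (U ** E ** ctranspose U) = U ** (D ** E) ** ctranspose U"
proof -
  have "(U ** D ** ctranspose U) ** (U ** E ** ctranspose U)
      = U ** (D ** ((ctranspose U ** U) ** E)) ** ctranspose U"
    by (simp only: matrix_mul_assoc)
  also have "\<dots> = U ** (D ** E) ** ctranspose U"
    using assms by (simp add: unitary_def)
  finally show ?thesis .
qed

lemma qf_axis: "qf A (axis i 1) = Re (A $ i $ i)"
proof -
  have "quad_form A (axis i 1) = (\<Sum>k\<in>UNIV. \<Sum>j\<in>UNIV. if k = i \<and> j = i then A $ i $ i else 0)"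
    unfolding quad_form_def by (intro sum.cong) (auto simp: axis_def)
  also have "\<dots> = (\<Sum>k\<in>UNIV. if k = i then A $ i $ i else 0)"
    by (intro sum.cong) auto
  finally show ?thesis by (simp add: qf_def)
qed

lemma diag_mat_qf_nonneg:
  fixes A :: "complex^'n^'n"
  assumes "unitary U" "A = U ** diag_mat (\<lambda>i. of_real (d i)) ** ctranspose U" "A \<in> psd_cone"
  shows "0 \<le> d i"
proof -
  let ?D = "diag_mat (\<lambda>i. complex_of_real (d i)) :: complex^'n^'n"
  have "ctranspose U ** A ** U = (ctranspose U ** U) ** ?D ** (ctranspose U ** U)"
    unfolding assms(2) by (simp only: matrix_mul_assoc)
  also have "\<dots> = ?D" using assms(1) by (simp add: unitary_def)
  finally have "qf ?D (axis i 1) = qf A (U *v axis i 1)" using qf_congruence by metis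
  moreover have "qf ?D (axis i 1) = d i" by (simp add: qf_axis diag_mat_def)
  ultimately show ?thesis using psd_cone_qf[OF assms(3)] by metis
qed

text \<open>One diagonalisation is fixed per matrix, so that all its powers share the same unitary
  and the exponent laws reduce to diagonal matrices.\<close>

definition eig :: "complex^'n^'n \<Rightarrow> (complex^'n^'n) \<times> ('n \<Rightarrow> real)" where
  "eig A = (SOME p. unitary (fst p)
      \<and> A = fst p ** diag_mat (\<lambda>i. of_real (snd p i)) ** ctranspose (fst p))"

text \<open>Since \<open>0 powr z = 0\<close>, the kernel of \<open>A\<close> stays the kernel of every power; in particular
  \<open>cpow A 0\<close> is the projection onto the range of \<open>A\<close>, and negative powers are generalised inverses.\<close>

definition cpow :: "complex^'n^'n \<Rightarrow> complex \<Rightarrow> complex^'n^'n" where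
  "cpow A z = fst (eig A) ** diag_mat (\<lambda>i. of_real (snd (eig A) i) powr z) ** ctranspose (fst (eig A))"

lemma cpow_diagE:
  fixes A :: "complex^'n^'n"
  assumes "A \<in> psd_cone"
  obtains U d where "unitary U" "A = U ** diag_mat (\<lambda>i. of_real (d i)) ** ctranspose U"
    "\<And>i. 0 \<le> d i" "\<And>z. cpow A z = U ** diag_mat (\<lambda>i. of_real (d i) powr z) ** ctranspose U"
proof -
  obtain U d where "unitary U \<and> A = U ** diag_mat (\<lambda>i. of_real (d i)) ** ctranspose U"
    using hermitian_diagonalization[OF psd_cone_hermitian[OF assms]] by blast
  hence "\<exists>p. unitary (fst p)
      \<and> A = fst p ** diag_mat (\<lambda>i. of_real (snd p i)) ** ctranspose (fst p)"
    by (intro exI[of _ "(U, d)"]) simp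
  hence *: "unitary (fst (eig A))"
      "A = fst (eig A) ** diag_mat (\<lambda>i. of_real (snd (eig A) i)) ** ctranspose (fst (eig A))"
    unfolding eig_def by (rule someI2_ex, blast)+
  show ?thesis
    by (rule that[OF * diag_mat_qf_nonneg[OF * assms] cpow_def])
qed

lemma cpow_add:
  assumes "A \<in> psd_cone"
  shows "cpow A (z + w) = cpow A z ** cpow A w"
proof (rule cpow_diagE[OF assms], goal_cases)
  case (1 U d)
  show ?case unfolding 1(4) by (simp add: unitary_conj_mult[OF 1(1)] diag_mat_mult powr_add)
qed

lemma cpow_one:
  assumes "A \<in> psd_cone"
  shows "cpow A 1 = A"
proof (rule cpow_diagE[OF assms], goal_cases)
  case (1 U d)
  have "complex_of_real (d i) powr 1 = of_real (d i)" for i by (simp add: powr_def)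
  thus ?case using 1(2) 1(4)[of 1] by simp
qed

lemma ctranspose_cpow:
  assumes "A \<in> psd_cone"
  shows "ctranspose (cpow A z) = cpow A (cnj z)"
proof (rule cpow_diagE[OF assms], goal_cases)
  case (1 U d)
  have "cnj (of_real (d i) powr z) = of_real (d i) powr (cnj z)" for i
    using 1(3)[of i] by (auto simp: powr_def Ln_of_real exp_cnj)
  thus ?case by (simp add: 1(4) ctranspose_mult ctranspose_diag_mat matrix_mul_assoc)
qed

text \<open>Exponent 0 is excluded: \<open>psd_power A 0\<close> is the identity,
  \<open>cpow A 0\<close> only the range projection.\<close>

lemma psd_power_eq_cpow:
  assumes "A \<in> psd_cone" "r \<noteq> 0"
  shows "psd_power A r = cpow A (of_real r)"
proof (rule cpow_diagE[OF assms(1)], goal_cases)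
  case (1 U d)
  show ?case
    unfolding psd_power_def 1(4)[of "of_real r"]
    by (subst spectral_fun_eqI[OF 1(1,2)]) (simp add: assms(2) powr_of_real 1(3))
qed

lemma psd_power_zero:
  assumes "A \<in> psd_cone"
  shows "psd_power A 0 = mat 1"
proof (rule cpow_diagE[OF assms], goal_cases)
  case (1 U d)
  have "diag_mat (\<lambda>i. 1) = (mat 1 :: complex^'a^'a)" by (simp add: diag_mat_def mat_def)
  thus ?case
    unfolding psd_power_def by (subst spectral_fun_eqI[OF 1(1,2)]) (simp add: 1(1) unitary_right)
qed

text \<open>Imaginary parts of exponents cancel in Gram matrices; this makes the estimates uniform
  along vertical lines.\<close>

lemma cpow_gram:
  assumes "A \<in> psd_cone"
  shows "ctranspose (cpow A z) ** cpow A z = cpow A (of_real (2 * Re z))"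
  using assms by (simp add: ctranspose_cpow complex_add_cnj add.commute flip: cpow_add)

lemma psd_cone_cpow:
  assumes "A \<in> psd_cone"
  shows "cpow A (of_real r) \<in> psd_cone"
  using psd_cone_gram[of "cpow A (of_real (r / 2))"] by (simp add: cpow_gram[OF assms])

text \<open>A zero eigenvalue contributes 0 for every exponent, so negative real parts create no
  singularity. The rigid affine shape of the exponent explains summands such as
  \<open>of_real 0\<close> in the interpolating families.\<close>

lemma strip_bounded_matrix_cpow:
  assumes "A \<in> psd_cone"
  shows "strip_bounded_matrix (\<lambda>z. cpow A (of_real a * z + of_real b))"
proof (rule cpow_diagE[OF assms], goal_cases)
  case (1 U d)
  have "strip_bounded (\<lambda>z. of_real (d i) powr (of_real a * z + of_real b))" for i
    using 1(3)[of i] strip_bounded_exp_affine[of a b "ln (d i)"]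
    by (cases "d i = 0") (auto simp: powr_def strip_bounded_const Ln_of_real)
  hence "strip_bounded_matrix (\<lambda>z. diag_mat (\<lambda>i. of_real (d i) powr (of_real a * z + of_real b)))"
    unfolding strip_bounded_matrix_def
  proof (intro allI)
    fix i j
    assume *: "strip_bounded (\<lambda>z. of_real (d i) powr (of_real a * z + of_real b))" for i
    show "strip_bounded (\<lambda>z. diag_mat (\<lambda>i. of_real (d i) powr (of_real a * z + of_real b)) $ i $ j)"
      using *[of i] by (cases "i = j") (simp_all add: diag_mat_def strip_bounded_const)
  qed
  thus ?case
    unfolding 1(4) by (intro strip_bounded_matrix_mult strip_bounded_matrix_const)
qed


subsection \<open>Contractions\<close>

definition contraction :: "complex^'n^'n \<Rightarrow> bool" where
  "contraction M \<longleftrightarrow> (\<forall>v. norm (M *v v) \<le> norm v)"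

lemma contraction_mult: "contraction A \<Longrightarrow> contraction B \<Longrightarrow> contraction (A ** B)"
  unfolding contraction_def matrix_vector_mul_assoc[symmetric] by (blast intro: order_trans)

lemma contraction_ctranspose:
  assumes "contraction M"
  shows "contraction (ctranspose M)"
  unfolding contraction_def
proof
  fix v
  let ?u = "ctranspose M *v v"
  have "(norm ?u)\<^sup>2 = norm (cinner ?u ?u)" by (simp add: cinner_self norm_power)
  also have "\<dots> = norm (cinner v (M *v ?u))" by (simp add: cinner_adjoint)
  also have "\<dots> \<le> norm v * norm ?u"
    using norm_cinner_le[of v "M *v ?u"] assms
    by (meson contraction_def mult_left_mono norm_ge_zero order_trans)
  finally have "norm ?u * norm ?u \<le> norm v * norm ?u" by (simp add: power2_eq_square)
  thus "norm ?u \<le> norm v"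
    by (cases "norm ?u = 0") (simp, metis mult_right_le_imp_le norm_ge_zero order_le_less)
qed

lemma unitary_norm:
  assumes "unitary U"
  shows "norm (U *v v) = norm v"
proof -
  have "cinner (U *v v) (U *v v) = cinner (ctranspose U *v (U *v v)) v"
    by (rule cinner_adjoint)
  also have "\<dots> = cinner v v"
    using assms by (simp add: matrix_vector_mul_assoc unitary_def)
  finally have "(norm (U *v v))\<^sup>2 = (norm v)\<^sup>2"
    unfolding cinner_self of_real_eq_iff .
  thus ?thesis by (simp add: power2_eq_iff_nonneg)
qed

lemma unitary_ctranspose: "unitary U \<Longrightarrow> unitary (ctranspose U)"
  by (simp add: unitary_def unitary_right)

text \<open>The eigenvalues have modulus 1 on the range of \<open>A\<close> and are 0 on its
  kernel.\<close>

lemma contraction_cpow_imaginary: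
  assumes "A \<in> psd_cone" "Re z = 0"
  shows "contraction (cpow A z)"
proof (rule cpow_diagE[OF assms(1)], goal_cases)
  case (1 U d)
  have "norm (diag_mat (\<lambda>i. of_real (d i) powr z) *v w) \<le> norm w" for w :: "complex^'a"
    unfolding norm_vec_def
  proof (rule L2_set_mono)
    fix i :: 'a
    have "norm (of_real (d i) powr z :: complex) \<le> 1"
      using assms(2) 1(3)[of i] by (cases "d i = 0") (auto simp: norm_powr_real_powr)
    thus "norm ((diag_mat (\<lambda>i. of_real (d i) powr z) *v w) $ i) \<le> norm (w $ i)"
      by (simp add: diag_mat_mult_vec norm_mult mult_left_le_one_le)
  qed simp
  thus ?case
    unfolding contraction_def 1(4)
    by (metis 1(1) matrix_vector_mul_assoc unitary_ctranspose unitary_norm)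
qed


subsection \<open>The Loewner-Heinz inequality\<close>

text \<open>The vector \<open>v - cpow R 0 *v v\<close> lies in the kernel of \<open>R\<close>,
  where the bound forces \<open>S\<close> to vanish.\<close>

lemma absorb_support:
  assumes R: "R \<in> psd_cone" and le: "\<And>v. (norm (S *v v))\<^sup>2 \<le> c * qf R v"
  shows "S ** cpow R 0 = S"
proof -
  have "S *v v = S *v (cpow R 0 *v v)" for v
  proof -
    let ?u = "v - cpow R 0 *v v"
    have "R ** cpow R 0 = R" using cpow_add[OF R, of 1 0] by (simp add: cpow_one R)
    hence "R *v ?u = 0" by (simp add: matrix_vector_mult_diff_distrib matrix_vector_mul_assoc)
    hence "qf R ?u = 0" by (simp add: qf_def quad_form_eq cinner_def)
    hence "S *v ?u = 0" using le[of ?u] by simp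
    thus ?thesis by (simp add: matrix_vector_mult_diff_distrib)
  qed
  thus ?thesis by (simp add: matrix_eq flip: matrix_vector_mul_assoc)
qed

text \<open>Domination of quadratic forms propagates kernels: \<open>P\<close> factors through the support of \<open>R\<close>.\<close>

lemma cpow_absorb_support:
  assumes P: "P \<in> psd_cone" and R: "R \<in> psd_cone" and le: "\<And>v. qf P v \<le> c * qf R v"
  shows "cpow P z ** cpow R 0 = cpow P z"
proof -
  let ?S = "cpow P (of_real (1 / 2))"
  have "(norm (?S *v v))\<^sup>2 = qf P v" for v
    using cpow_gram[OF P, of "of_real (1 / 2)"] qf_gram[of ?S v] by (simp add: cpow_one P)
  hence S: "?S ** cpow R 0 = ?S" using absorb_support[OF R, of ?S c] le by simp
  have "cpow P z = cpow P (z - of_real (1 / 2)) ** ?S" by (simp flip: cpow_add[OF P])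
  thus ?thesis by (metis S matrix_mul_assoc)
qed

text \<open>The product of opposite powers of \<open>R\<close> is only the support projection of
  \<open>R\<close>, which the powers of the dominated \<open>P\<close> absorb.\<close>

lemma cpow_cancel:
  assumes "P \<in> psd_cone" "R \<in> psd_cone" "\<And>v. qf P v \<le> c * qf R v"
  shows "cpow P z ** cpow R (- w) ** cpow R w = cpow P z"
  using cpow_absorb_support[OF assms] cpow_add[OF assms(2), of "- w" w]
  by (simp flip: matrix_mul_assoc)

lemma qf_le_of_combination:
  assumes "0 < a" "0 \<le> b" "Q \<in> psd_cone" "\<And>v. a * qf P v + b * qf Q v \<le> qf R v"
  shows "qf P v \<le> (1 / a) * qf R v"
  using assms(4)[of v] assms(1,2) psd_cone_qf[OF assms(3), of v]
  by (smt (verit) divide_inverse_commute inverse_eq_divide le_divide_eq mult.commute mult_nonneg_nonneg)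

lemma sqrt_weighted_Cauchy:
  fixes a b :: real
  assumes "0 \<le> a" "0 \<le> b"
  shows "a * (x * y) + b * (z * w) \<le> sqrt (a * x\<^sup>2 + b * z\<^sup>2) * sqrt (a * y\<^sup>2 + b * w\<^sup>2)"
proof -
  have "(a * (x * y) + b * (z * w))\<^sup>2 \<le> (a * x\<^sup>2 + b * z\<^sup>2) * (a * y\<^sup>2 + b * w\<^sup>2)"
  proof -
    have "(a * x\<^sup>2 + b * z\<^sup>2) * (a * y\<^sup>2 + b * w\<^sup>2) - (a * (x * y) + b * (z * w))\<^sup>2
        = a * b * (x * w - z * y)\<^sup>2"
      by (simp add: power2_eq_square algebra_simps)
    thus ?thesis using assms by (smt (verit) mult_nonneg_nonneg zero_le_power2)
  qed
  hence "a * (x * y) + b * (z * w) \<le> sqrt ((a * x\<^sup>2 + b * z\<^sup>2) * (a * y\<^sup>2 + b * w\<^sup>2))"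
    by (rule real_le_rsqrt)
  thus ?thesis by (simp add: real_sqrt_mult)
qed

text \<open>With the vectors \<open>x\<close> and \<open>y\<close> frozen at exponent q,
  \<open>h\<close> takes the value \<open>L\<close>, the left-hand side, at z = q. Both edges give
  the bound sqrt L |w|: Re z = 0 by a + b \<le> 1, Re z = 1 by the domination hypothesis. The three
  lines theorem then yields L \<le> |w|^2. Taking P = Q and a + b = 1 gives operator
  monotonicity.\<close>

theorem Loewner_Heinz_concave:
  fixes P Q R :: "complex^'n^'n"
  assumes P: "P \<in> psd_cone" and Q: "Q \<in> psd_cone" and R: "R \<in> psd_cone"
    and a: "0 < a" and b: "0 < b" and ab: "a + b \<le> 1"
    and le: "\<And>v. a * qf P v + b * qf Q v \<le> qf R v"
    and q: "0 \<le> q" "q \<le> 1"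
  shows "a * qf (cpow P (of_real q)) v + b * qf (cpow Q (of_real q)) v \<le> qf (cpow R (of_real q)) v"
proof -
  define w where "w = cpow R (of_real (q / 2)) *v v"
  define x y where "x = cpow P (of_real (q / 2)) *v v" and "y = cpow Q (of_real (q / 2)) *v v"
  define F where "F X z = cpow X (of_real (1 / 2) * z) ** cpow R (of_real (- (1 / 2)) * z)" for X z
  define h where "h z = of_real a * cinner x (F P z *v w) + of_real b * cinner y (F Q z *v w)" for z
  have qf_half: "qf (cpow X (of_real q)) v = (norm (cpow X (of_real (q / 2)) *v v))\<^sup>2"
    if "X \<in> psd_cone" for X
    using cpow_gram[OF that, of "of_real (q / 2)"] qf_gram[of "cpow X (of_real (q / 2))" v] by simp
  define L where "L = a * (norm x)\<^sup>2 + b * (norm y)\<^sup>2"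
  have L0: "0 \<le> L" using a b by (simp add: L_def)
  have leP: "\<And>v. qf P v \<le> (1 / a) * qf R v"
    using qf_le_of_combination[OF a less_imp_le[OF b] Q le] .
  have leQ: "\<And>v. qf Q v \<le> (1 / b) * qf R v"
    using qf_le_of_combination[of b a P Q R] a b P le by (smt (verit))
  have F: "strip_bounded_matrix (F X)" if "X \<in> psd_cone" for X
    using strip_bounded_matrix_cpow[OF that, of "1/2" 0] strip_bounded_matrix_cpow[OF R, of "-(1/2)" 0]
    unfolding F_def by (intro strip_bounded_matrix_mult) simp_all
  have hb: "strip_bounded h"
    unfolding h_def
    by (intro strip_bounded_add strip_bounded_mult strip_bounded_const strip_bounded_cinner F P Q)
  have FP: "F P (of_real q) *v w = x"
    using cpow_cancel[OF P R leP, of "of_real (q / 2)" "of_real (q / 2)"]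
    by (simp add: F_def w_def x_def matrix_vector_mul_assoc)
  have FQ: "F Q (of_real q) *v w = y"
    using cpow_cancel[OF Q R leQ, of "of_real (q / 2)" "of_real (q / 2)"]
    by (simp add: F_def w_def y_def matrix_vector_mul_assoc)
  have hq: "h (of_real q) = of_real L"
    unfolding h_def FP FQ by (simp add: cinner_self L_def)
  have hle: "norm (h z) \<le> sqrt L * sqrt (a * (norm (F P z *v w))\<^sup>2 + b * (norm (F Q z *v w))\<^sup>2)" for z
  proof -
    have "norm (h z) \<le> a * norm (cinner x (F P z *v w)) + b * norm (cinner y (F Q z *v w))"
      unfolding h_def using a b by (intro order_trans[OF norm_triangle_ineq]) (simp add: norm_mult)
    also have "\<dots> \<le> a * (norm x * norm (F P z *v w)) + b * (norm y * norm (F Q z *v w))"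
      using a b by (intro add_mono mult_left_mono norm_cinner_le) auto
    also have "\<dots> \<le> sqrt L * sqrt (a * (norm (F P z *v w))\<^sup>2 + b * (norm (F Q z *v w))\<^sup>2)"
      unfolding L_def using a b by (intro sqrt_weighted_Cauchy) auto
    finally show ?thesis .
  qed
  have "norm (h z) \<le> sqrt L * norm w" if "Re z = 0 \<or> Re z = 1" for z
  proof -
    have "a * (norm (F P z *v w))\<^sup>2 + b * (norm (F Q z *v w))\<^sup>2 \<le> (norm w)\<^sup>2"
      using that
    proof
      assume z: "Re z = 0"
      have "norm (F X z *v w) \<le> norm w" if "X \<in> psd_cone" for X
        using contraction_mult[OF contraction_cpow_imaginary[OF that]
            contraction_cpow_imaginary[OF R], of "of_real (1 / 2) * z" "of_real (- (1 / 2)) * z"] z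
        unfolding F_def contraction_def by simp
      hence "a * (norm (F P z *v w))\<^sup>2 + b * (norm (F Q z *v w))\<^sup>2 \<le> a * (norm w)\<^sup>2 + b * (norm w)\<^sup>2"
        using a b P Q by (intro add_mono mult_left_mono power_mono) auto
      also have "\<dots> \<le> 1 * (norm w)\<^sup>2"
        unfolding distrib_right[symmetric] using ab by (intro mult_right_mono) auto
      finally show ?thesis by simp
    next
      assume z: "Re z = 1"
      let ?u = "cpow R (of_real (- (1 / 2)) * z) *v w"
      have "(norm (F X z *v w))\<^sup>2 = qf X ?u" if "X \<in> psd_cone" for X
        using qf_gram[of "cpow X (of_real (1 / 2) * z)" ?u] cpow_gram[OF that, of "of_real (1 / 2) * z"] z
        by (simp add: F_def cpow_one that matrix_vector_mul_assoc)
      hence "a * (norm (F P z *v w))\<^sup>2 + b * (norm (F Q z *v w))\<^sup>2 \<le> qf R ?u"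
        using le P Q by simp
      also have "\<dots> = (norm (cpow R (of_real (1 / 2)) *v ?u))\<^sup>2"
        using qf_gram[of "cpow R (of_real (1 / 2))" ?u] cpow_gram[OF R, of "of_real (1 / 2)"]
        by (simp add: cpow_one R)
      also have "\<dots> \<le> (norm w)\<^sup>2"
      proof -
        have "cpow R (of_real (1 / 2)) ** cpow R (of_real (- (1 / 2)) * z) = cpow R ((1 - z) / 2)"
          by (simp add: field_simps flip: cpow_add[OF R])
        hence "cpow R (of_real (1 / 2)) *v ?u = cpow R ((1 - z) / 2) *v w"
          by (simp add: matrix_vector_mul_assoc)
        moreover have "contraction (cpow R ((1 - z) / 2))"
          using z by (intro contraction_cpow_imaginary R) simp
        ultimately show ?thesis by (simp add: contraction_def)
      qed
      finally show ?thesis .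
    qed
    hence "sqrt (a * (norm (F P z *v w))\<^sup>2 + b * (norm (F Q z *v w))\<^sup>2) \<le> norm w"
      by (simp add: real_le_lsqrt)
    thus ?thesis 
      using order_trans[OF hle[of z] mult_left_mono] L0 by simp
  qed
  moreover have "of_real q \<in> strip" using q by (simp add: strip_def)
  ultimately have "norm (h (of_real q)) \<le> sqrt L * norm w"
    using strip_maximum_principle[OF hb] by blast
  hence "L \<le> sqrt L * norm w" using L0 by (simp add: hq)
  hence "sqrt L * sqrt L \<le> sqrt L * norm w" using L0 by simp
  hence "sqrt L \<le> norm w"
    using L0 mult_le_cancel_left_pos[of "sqrt L" "sqrt L" "norm w"] by (cases "L = 0") auto
  hence "(sqrt L)\<^sup>2 \<le> (norm w)\<^sup>2" using L0 by (intro power_mono) auto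
  hence "L \<le> (norm w)\<^sup>2" using L0 by simp
  thus ?thesis by (simp only: qf_half P Q R L_def w_def x_def y_def)
qed

subsection \<open>Minors indexed by functions\<close>

text \<open>The determinant with rows chosen by \<open>f\<close> and columns by \<open>g\<close>.
  Maps instead of increasing index sets require no order on the index type and cost only factors
  \<open>fact k\<close>.\<close>

definition minor :: "nat \<Rightarrow> complex^'n^'n \<Rightarrow> (nat \<Rightarrow> 'n) \<Rightarrow> (nat \<Rightarrow> 'n) \<Rightarrow> complex" where
  "minor k M f g = (\<Sum>p | p permutes {..<k}. of_int (sign p) * (\<Prod>j<k. M $ f j $ g (p j)))"

abbreviation index_maps :: "nat \<Rightarrow> (nat \<Rightarrow> 'n) set" where
  "index_maps k \<equiv> PiE {..<k} (\<lambda>_. UNIV)"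

text \<open>The trace of the \<open>k\<close>-th exterior power of \<open>M\<close>. Each \<open>k\<close>-set of indices is enumerated by
  \<open>fact k\<close> injective maps; non-injective maps contribute 0.\<close>

definition minor_sum :: "nat \<Rightarrow> complex^'n^'n \<Rightarrow> complex" where
  "minor_sum k M = (\<Sum>f\<in>index_maps k. minor k M f f) / fact k"

lemma prod_sum_index_maps:
  fixes c :: "nat \<Rightarrow> 'n::finite \<Rightarrow> complex"
  shows "(\<Sum>g\<in>index_maps k. \<Prod>j<k. c j (g j)) = (\<Prod>j<k. \<Sum>i\<in>UNIV. c j i)"
  by (rule prod_sum_PiE[symmetric]) auto

text \<open>For fixed p, reindexing moves p into the row indices, the sum over \<open>g\<close>
  factorises into entries of \<open>A ** B\<close>, and \<open>q \<circ> p\<close> runs through all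
  permutations. Each of the \<open>fact k\<close> choices of p thus contributes the same
  minor.\<close>

lemma minor_Cauchy_Binet:
  fixes A B :: "complex^'n^'n"
  shows "(\<Sum>g\<in>index_maps k. minor k A f g * minor k B g h) = fact k * minor k (A ** B) f h"
proof -
  let ?P = "{p. p permutes {..<k}}"
  let ?s = "\<lambda>p. complex_of_int (sign p)"
  have inner: "(\<Sum>q\<in>?P. ?s p * ?s q * (\<Sum>g\<in>index_maps k. (\<Prod>j<k. A $ f j $ g (p j)) * (\<Prod>j<k. B $ g j $ h (q j))))
      = minor k (A ** B) f h" if p: "p \<in> ?P" for p
  proof -
    have pp: "p permutes {..<k}" using p by simp
    have "?s p * ?s q * (\<Sum>g\<in>index_maps k. (\<Prod>j<k. A $ f j $ g (p j)) * (\<Prod>j<k. B $ g j $ h (q j)))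
        = ?s (q \<circ> p) * (\<Prod>j<k. (A ** B) $ f j $ h ((q \<circ> p) j))" if "q \<in> ?P" for q
    proof -
      have "(\<Prod>j<k. A $ f j $ g (p j)) = (\<Prod>j<k. A $ f (inv p j) $ g j)" for g
        by (subst prod.permute[OF pp]) (simp add: o_def permutes_inverses[OF pp])
      hence "(\<Sum>g\<in>index_maps k. (\<Prod>j<k. A $ f j $ g (p j)) * (\<Prod>j<k. B $ g j $ h (q j)))
          = (\<Sum>g\<in>index_maps k. \<Prod>j<k. A $ f (inv p j) $ g j * B $ g j $ h (q j))"
        by (simp add: prod.distrib)
      also have "\<dots> = (\<Prod>j<k. \<Sum>i\<in>UNIV. A $ f (inv p j) $ i * B $ i $ h (q j))"
        by (rule prod_sum_index_maps)
      also have "\<dots> = (\<Prod>j<k. (A ** B) $ f (inv p j) $ h (q j))"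
        by (simp add: matrix_matrix_mult_def)
      also have "\<dots> = (\<Prod>j<k. (A ** B) $ f j $ h ((q \<circ> p) j))"
        by (subst prod.permute[OF pp]) (simp add: o_def permutes_inverses[OF pp])
      finally have e: "(\<Sum>g\<in>index_maps k. (\<Prod>j<k. A $ f j $ g (p j)) * (\<Prod>j<k. B $ g j $ h (q j)))
          = (\<Prod>j<k. (A ** B) $ f j $ h ((q \<circ> p) j))" .
      have "sign (q \<circ> p) = sign q * sign p"
        using that p by (intro sign_compose) (auto intro: permutation_permutes[THEN iffD2])
      thus ?thesis unfolding e by simp
    qed
    hence "(\<Sum>q\<in>?P. ?s p * ?s q * (\<Sum>g\<in>index_maps k. (\<Prod>j<k. A $ f j $ g (p j)) * (\<Prod>j<k. B $ g j $ h (q j))))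
        = (\<Sum>q\<in>?P. ?s (q \<circ> p) * (\<Prod>j<k. (A ** B) $ f j $ h ((q \<circ> p) j)))"
      by (rule sum.cong[OF refl])
    also have "\<dots> = minor k (A ** B) f h"
      unfolding minor_def by (rule sum_permutations_compose_right[OF pp, symmetric])
    finally show ?thesis .
  qed
  have "(\<Sum>g\<in>index_maps k. minor k A f g * minor k B g h)
      = (\<Sum>g\<in>index_maps k. \<Sum>p\<in>?P. \<Sum>q\<in>?P. ?s p * ?s q * ((\<Prod>j<k. A $ f j $ g (p j)) * (\<Prod>j<k. B $ g j $ h (q j))))"
    unfolding minor_def sum_product by (simp add: mult_ac)
  also have "\<dots> = (\<Sum>p\<in>?P. \<Sum>g\<in>index_maps k. \<Sum>q\<in>?P. ?s p * ?s q * ((\<Prod>j<k. A $ f j $ g (p j)) * (\<Prod>j<k. B $ g j $ h (q j))))"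
    by (rule sum.swap)
  also have "\<dots> = (\<Sum>p\<in>?P. \<Sum>q\<in>?P. \<Sum>g\<in>index_maps k. ?s p * ?s q * ((\<Prod>j<k. A $ f j $ g (p j)) * (\<Prod>j<k. B $ g j $ h (q j))))"
    by (intro sum.cong refl sum.swap)
  also have "\<dots> = (\<Sum>p\<in>?P. minor k (A ** B) f h)"
    unfolding sum_distrib_left[symmetric] by (intro sum.cong refl inner)
  also have "\<dots> = fact k * minor k (A ** B) f h"
    by (simp add: card_permutations[of "{..<k}" k])
  finally show ?thesis .
qed

lemma minor_ctranspose: "minor k (ctranspose M) f g = cnj (minor k M g f)"
proof -
  have "minor k (ctranspose M) f g
      = (\<Sum>p | p permutes {..<k}. of_int (sign (inv p)) * (\<Prod>j<k. ctranspose M $ f j $ g (inv p j)))"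
    unfolding minor_def by (rule sum_permutations_inverse)
  also have "\<dots> = (\<Sum>p | p permutes {..<k}. cnj (of_int (sign p) * (\<Prod>j<k. M $ g j $ f (p j))))"
  proof (rule sum.cong[OF refl])
    fix p assume "p \<in> {p. p permutes {..<k}}"
    hence p: "p permutes {..<k}" by simp
    hence "sign (inv p) = sign p" by (intro sign_inverse) (auto intro: permutation_permutes[THEN iffD2])
    moreover have "(\<Prod>j<k. ctranspose M $ f j $ g (inv p j)) = (\<Prod>j<k. cnj (M $ g j $ f (p j)))"
      by (subst prod.permute[OF p]) (simp add: o_def permutes_inverses[OF p] ctranspose_nth)
    ultimately show "of_int (sign (inv p)) * (\<Prod>j<k. ctranspose M $ f j $ g (inv p j))
        = cnj (of_int (sign p) * (\<Prod>j<k. M $ g j $ f (p j)))" by simp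
  qed
  finally show ?thesis by (simp add: minor_def)
qed

lemma minor_sum_mult:
  fixes A B :: "complex^'n^'n"
  shows "minor_sum k (A ** B)
    = (\<Sum>f\<in>index_maps k. \<Sum>g\<in>index_maps k. minor k A f g * minor k B g f) / (fact k)\<^sup>2"
  by (simp add: minor_sum_def minor_Cauchy_Binet power2_eq_square flip: sum_distrib_left)

lemma minor_sum_commute:
  fixes A B :: "complex^'n^'n"
  shows "minor_sum k (A ** B) = minor_sum k (B ** A)"
  unfolding minor_sum_mult by (subst sum.swap) (simp add: mult.commute)

lemma minor_sum_gram:
  fixes A :: "complex^'n^'n"
  shows "minor_sum k (A ** ctranspose A)
    = of_real ((\<Sum>f\<in>index_maps k. \<Sum>g\<in>index_maps k. (norm (minor k A f g))\<^sup>2) / (fact k)\<^sup>2)"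
  by (simp add: minor_sum_mult minor_ctranspose flip: complex_norm_square)

text \<open>By \<open>minor_sum_mult\<close> the left side is a trace of a product of k-th compound
  matrices, so this is Cauchy-Schwarz for the Hilbert-Schmidt inner product on the exterior
  power.\<close>

lemma minor_sum_Cauchy_Schwarz:
  fixes A B :: "complex^'n^'n"
  shows "(norm (minor_sum k (A ** B)))\<^sup>2
    \<le> Re (minor_sum k (A ** ctranspose A)) * Re (minor_sum k (ctranspose B ** B))"
proof -
  let ?I = "index_maps k \<times> index_maps k :: ((nat \<Rightarrow> 'n) \<times> (nat \<Rightarrow> 'n)) set"
  let ?a = "\<lambda>(f, g). norm (minor k A f g)" and ?b = "\<lambda>(f, g). norm (minor k B g f)"
  have "norm (\<Sum>f\<in>index_maps k. \<Sum>g\<in>index_maps k. minor k A f g * minor k B g f)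
      = norm (\<Sum>(f, g)\<in>?I. minor k A f g * minor k B g f)"
    by (rule arg_cong[OF sum.cartesian_product])
  also have "\<dots> \<le> (\<Sum>x\<in>?I. ?a x * ?b x)"
    by (rule sum_norm_le) (clarsimp simp: norm_mult)
  finally have "(norm (\<Sum>f\<in>index_maps k. \<Sum>g\<in>index_maps k. minor k A f g * minor k B g f))\<^sup>2
      \<le> (\<Sum>x\<in>?I. ?a x * ?b x)\<^sup>2" by (rule power_mono) simp
  also have "\<dots> \<le> (\<Sum>x\<in>?I. (?a x)\<^sup>2) * (\<Sum>x\<in>?I. (?b x)\<^sup>2)" by (rule Cauchy_Schwarz_ineq_sum)
  also have "(\<Sum>x\<in>?I. (?a x)\<^sup>2) = (\<Sum>f\<in>index_maps k. \<Sum>g\<in>index_maps k. (norm (minor k A f g))\<^sup>2)"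
    by (subst sum.cartesian_product) (simp add: case_prod_unfold)
  also have "(\<Sum>x\<in>?I. (?b x)\<^sup>2) = (\<Sum>f\<in>index_maps k. \<Sum>g\<in>index_maps k. (norm (minor k B g f))\<^sup>2)"
    by (subst sum.cartesian_product) (simp add: case_prod_unfold)
  also have "\<dots> = (\<Sum>f\<in>index_maps k. \<Sum>g\<in>index_maps k. (norm (minor k B f g))\<^sup>2)" by (rule sum.swap)
  finally show ?thesis
    unfolding minor_sum_commute[of k "ctranspose B" B] minor_sum_gram
    unfolding minor_sum_mult Re_complex_of_real norm_divide norm_power power_divide times_divide_times_eq
    by (simp add: power2_eq_square divide_right_mono)
qed

text \<open>Transposing two positions with equal columns shows that the minor is its own
  negative.\<close>

lemma minor_not_inj:
  assumes "\<not> inj_on g {..<k}"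
  shows "minor k M f g = 0"
proof -
  obtain a b where ab: "a < k" "b < k" "a \<noteq> b" "g a = g b" using assms by (auto simp: inj_on_def)
  let ?t = "Transposition.transpose a b"
  have t: "?t permutes {..<k}" using ab by (intro permutes_swap_id) auto
  have "minor k M f g = (\<Sum>p | p permutes {..<k}. of_int (sign (?t \<circ> p)) * (\<Prod>j<k. M $ f j $ g ((?t \<circ> p) j)))"
    unfolding minor_def by (rule setum_permutations_compose_left[OF t])
  also have "\<dots> = (\<Sum>p | p permutes {..<k}. - (of_int (sign p) * (\<Prod>j<k. M $ f j $ g (p j))))"
  proof (rule sum.cong[OF refl])
    fix p assume "p \<in> {p. p permutes {..<k}}"
    hence "permutation p" by (auto intro: permutation_permutes[THEN iffD2])
    hence "sign (?t \<circ> p) = - sign p"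
      using ab by (simp add: sign_compose permutation_swap_id sign_swap_id)
    moreover have "g (?t x) = g x" for x using ab(4) by (simp add: Transposition.transpose_def)
    ultimately show "of_int (sign (?t \<circ> p)) * (\<Prod>j<k. M $ f j $ g ((?t \<circ> p) j))
        = - (of_int (sign p) * (\<Prod>j<k. M $ f j $ g (p j)))" by simp
  qed
  also have "\<dots> = - minor k M f g" by (simp add: minor_def sum_negf)
  finally show ?thesis by simp
qed

lemma minor_diag_mat:
  assumes "inj_on f {..<k}"
  shows "minor k (diag_mat d) f f = (\<Prod>j<k. d (f j))"
proof -
  have "minor k (diag_mat d) f f = (\<Sum>p | p permutes {..<k}. if p = id then (\<Prod>j<k. d (f j)) else 0)"
    unfolding minor_def
  proof (rule sum.cong[OF refl])
    fix p assume "p \<in> {p. p permutes {..<k}}"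
    hence p: "p permutes {..<k}" by simp
    show "of_int (sign p) * (\<Prod>j<k. diag_mat d $ f j $ f (p j)) = (if p = id then \<Prod>j<k. d (f j) else 0)"
    proof (cases "p = id")
      case True
      thus ?thesis by (simp add: diag_mat_def)
    next
      case False
      then obtain j where j: "p j \<noteq> j" by (auto simp: fun_eq_iff)
      hence jk: "j < k" using p by (auto simp: permutes_def)
      hence "p j < k" using permutes_in_image[OF p, of j] by simp
      hence "f (p j) \<noteq> f j" using assms j jk by (auto simp: inj_on_def)
      hence "diag_mat d $ f j $ f (p j) = 0" by (simp add: diag_mat_def)
      hence "(\<Prod>j<k. diag_mat d $ f j $ f (p j)) = 0" using jk by (intro prod_zero) auto
      thus ?thesis using False by simp
    qed
  qed
  also have "\<dots> = (\<Prod>j<k. d (f j))"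
    by (simp add: sum.delta finite_permutations permutes_id)
  finally show ?thesis .
qed

text \<open>Once an enumeration \<open>h\<close> of \<open>I\<close> is fixed, all others are
  \<open>h \<circ> p\<close> with a permutation p.\<close>

lemma card_bij_index_maps:
  fixes I :: "'n::finite set"
  assumes "card I = k"
  shows "card {f \<in> index_maps k. inj_on f {..<k} \<and> f ` {..<k} = I} = fact k"
proof -
  obtain h where h: "bij_betw h {..<k} I"
    using ex_bij_betw_nat_finite[of I] assms by (auto simp: atLeast0LessThan)
  let ?F = "{f \<in> index_maps k. inj_on f {..<k} \<and> f ` {..<k} = I}"
  have "bij_betw (\<lambda>p. restrict (h \<circ> p) {..<k}) {p. p permutes {..<k}} ?F"
  proof (rule bij_betwI')
    fix p q assume "p \<in> {p. p permutes {..<k}}" "q \<in> {p. p permutes {..<k}}"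
    hence p: "p permutes {..<k}" and q: "q permutes {..<k}" by auto
    show "(restrict (h \<circ> p) {..<k} = restrict (h \<circ> q) {..<k}) = (p = q)"
    proof
      assume e: "restrict (h \<circ> p) {..<k} = restrict (h \<circ> q) {..<k}"
      show "p = q"
      proof
        fix x
        show "p x = q x"
        proof (cases "x < k")
          case True
          hence "h (p x) = h (q x)" using fun_cong[OF e, of x] by simp
          moreover have "p x < k" "q x < k"
            using True permutes_in_image[OF p, of x] permutes_in_image[OF q, of x] by auto
          ultimately show ?thesis using h by (auto simp: bij_betw_def inj_on_def)
        qed (use p q in \<open>auto simp: permutes_def\<close>)
      qed
    qed simp
  next
    fix p assume "p \<in> {p. p permutes {..<k}}"
    hence "bij_betw p {..<k} {..<k}" using permutes_imp_bij by auto
    hence "bij_betw (h \<circ> p) {..<k} I" using h bij_betw_trans by blast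
    thus "restrict (h \<circ> p) {..<k} \<in> ?F" by (auto simp: bij_betw_def inj_on_def)
  next
    fix f assume f: "f \<in> ?F"
    define p where "p j = (if j < k then inv_into {..<k} h (f j) else j)" for j
    have "bij_betw f {..<k} I" using f by (auto simp: bij_betw_def)
    hence "bij_betw (inv_into {..<k} h \<circ> f) {..<k} {..<k}"
      using bij_betw_inv_into[OF h] bij_betw_trans by blast
    hence "bij_betw p {..<k} {..<k}"
      by (rule bij_betw_cong[THEN iffD1, rotated]) (simp add: p_def)
    hence "p permutes {..<k}" by (rule bij_imp_permutes) (simp add: p_def)
    moreover have "f = restrict (h \<circ> p) {..<k}"
    proof
      fix j
      show "f j = restrict (h \<circ> p) {..<k} j"
      proof (cases "j < k")
        case True
        hence "f j \<in> h ` {..<k}" using f h by (auto simp: bij_betw_def)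
        thus ?thesis using True by (simp add: p_def f_inv_into_f)
      qed (use f in \<open>auto simp: PiE_def extensional_def\<close>)
    qed
    ultimately show "\<exists>p\<in>{p. p permutes {..<k}}. f = restrict (h \<circ> p) {..<k}" by blast
  qed
  thus ?thesis using bij_betw_same_card card_permutations[of "{..<k}" k] by fastforce
qed

lemma sum_inj_index_maps:
  fixes d :: "'n::finite \<Rightarrow> 'a::{comm_ring_1, semiring_char_0}"
  shows "(\<Sum>f | f \<in> index_maps k \<and> inj_on f {..<k}. \<Prod>j<k. d (f j)) = fact k * elem_sym k d"
proof -
  let ?J = "{f \<in> index_maps k. inj_on f {..<k}} :: (nat \<Rightarrow> 'n) set"
  have fin: "finite ?J" by (rule finite_subset[of _ "index_maps k"]) (auto intro: finite_PiE)
  have "(\<Sum>f\<in>?J. \<Prod>j<k. d (f j)) = (\<Sum>I\<in>{I. card I = k}. \<Sum>f\<in>{f \<in> ?J. f ` {..<k} = I}. \<Prod>j<k. d (f j))"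
    using sum.group[of ?J "{I. card I = k}" "\<lambda>f. f ` {..<k}" "\<lambda>f. \<Prod>j<k. d (f j)", OF fin]
    by (force simp: card_image)
  also have "\<dots> = (\<Sum>I\<in>{I. card I = k}. fact k * (\<Prod>i\<in>I. d i))"
  proof (rule sum.cong[OF refl])
    fix I :: "'n set" assume "I \<in> {I. card I = k}"
    hence I: "card I = k" by simp
    have "(\<Sum>f\<in>{f \<in> ?J. f ` {..<k} = I}. \<Prod>j<k. d (f j)) = (\<Sum>f\<in>{f \<in> ?J. f ` {..<k} = I}. \<Prod>i\<in>I. d i)"
    proof (rule sum.cong[OF refl])
      fix f assume "f \<in> {f \<in> ?J. f ` {..<k} = I}"
      hence "inj_on f {..<k}" "f ` {..<k} = I" by auto
      thus "(\<Prod>j<k. d (f j)) = (\<Prod>i\<in>I. d i)" using prod.reindex[of f "{..<k}" d] by (simp add: o_def)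
    qed
    also have "{f \<in> ?J. f ` {..<k} = I} = {f \<in> index_maps k. inj_on f {..<k} \<and> f ` {..<k} = I}" by auto
    also have "(\<Sum>f\<in>\<dots>. \<Prod>i\<in>I. d i) = fact k * (\<Prod>i\<in>I. d i)"
      by (simp add: card_bij_index_maps[OF I])
    finally show "(\<Sum>f\<in>{f \<in> ?J. f ` {..<k} = I}. \<Prod>j<k. d (f j)) = fact k * (\<Prod>i\<in>I. d i)"
      by (simp only: mem_Collect_eq conj_assoc)
  qed
  finally show ?thesis by (simp add: elem_sym_def sum_distrib_left)
qed

lemma minor_sum_inj:
  fixes M :: "complex^'n^'n"
  shows "minor_sum k M = (\<Sum>f | f \<in> index_maps k \<and> inj_on f {..<k}. minor k M f f) / fact k"
proof -
  have "finite (index_maps k :: (nat \<Rightarrow> 'n) set)" by (auto intro: finite_PiE)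
  hence "(\<Sum>f\<in>index_maps k. minor k M f f) = (\<Sum>f | f \<in> index_maps k \<and> inj_on f {..<k}. minor k M f f)"
    by (intro sum.mono_neutral_right) (auto simp: minor_not_inj)
  thus ?thesis by (simp add: minor_sum_def)
qed

lemma minor_sum_diag_mat: "minor_sum k (diag_mat d) = elem_sym k d"
proof -
  have "(\<Sum>f | f \<in> index_maps k \<and> inj_on f {..<k}. minor k (diag_mat d) f f)
      = (\<Sum>f | f \<in> index_maps k \<and> inj_on f {..<k}. \<Prod>j<k. d (f j))"
    by (rule sum.cong) (auto simp: minor_diag_mat)
  thus ?thesis by (simp add: minor_sum_inj sum_inj_index_maps)
qed

lemma minor_sum_unitary_conj:
  assumes "unitary U"
  shows "minor_sum k (U ** M ** ctranspose U) = minor_sum k M"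
  using assms minor_sum_commute[of k "U ** M" "ctranspose U"]
  by (simp add: matrix_mul_assoc unitary_def)

section \<open>Elementary symmetric polynomials of the eigenvalues\<close>

lemma elem_sym_of_real: "elem_sym k (\<lambda>i. of_real (d i)) = (of_real (elem_sym k d) :: complex)"
  by (simp add: elem_sym_def)

text \<open>Equal polynomials have equal root multisets, so the enumerations differ by a
  permutation; this removes the arbitrary choice in \<open>eigenvals\<close>.\<close>

lemma elem_sym_charpoly_unique:
  fixes d e :: "'n::finite \<Rightarrow> complex"
  assumes "(\<Prod>i\<in>UNIV. [:- d i, 1:]) = (\<Prod>i\<in>UNIV. [:- e i, 1:])"
  shows "elem_sym k d = elem_sym k e"
proof -
  have r: "proots (\<Prod>i\<in>UNIV. [:- c i, 1:]) = image_mset c (mset_set UNIV)" for c :: "'n \<Rightarrow> complex"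
  proof -
    have "proots (\<Prod>i\<in>I. [:- c i, 1:]) = image_mset c (mset_set I)" if "finite I" for I :: "'n set"
      using that by induction (auto simp: proots_mult simp del: mult_pCons_left)
    thus ?thesis by simp
  qed
  have "image_mset d (mset_set UNIV) = image_mset e (mset_set UNIV)"
    using arg_cong[OF assms, of proots] unfolding r .
  then obtain p where p: "p permutes (UNIV :: 'n set)" "\<forall>x\<in>UNIV. d x = e (p x)"
    by (rule image_mset_eq_implies_permutes[OF finite])
  have b: "bij p" using p(1) permutes_bij by blast
  have "elem_sym k d = (\<Sum>I | card I = k. \<Prod>i\<in>p ` I. e i)"
    unfolding elem_sym_def
    using p(2) b by (intro sum.cong refl) (simp add: prod.reindex[OF inj_on_subset[OF bij_is_inj]])
  also have "\<dots> = elem_sym k e"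
    unfolding elem_sym_def
  proof (rule sum.reindex_bij_betw)
    have c: "card (p ` I) = card I" for I using b by (intro card_image inj_on_subset[OF bij_is_inj]) auto
    have pinv: "p (inv p x) = x" for x using b by (simp add: bij_is_surj surj_f_inv_f)
    show "bij_betw ((`) p) {I. card I = k} {I. card I = k}"
    proof (rule bij_betw_byWitness[where f' = "(`) (inv p)"])
      show "(`) (inv p) ` {I. card I = k} \<subseteq> {I. card I = k}"
        using card_image[OF inj_on_subset[OF bij_is_inj[OF bij_imp_bij_inv[OF b]]]] by auto
    qed (use b c in \<open>auto simp: image_comp o_def bij_is_inj pinv\<close>)
  qed
  finally show ?thesis .
qed

lemma map_matrix_mult_const_poly:
  fixes A B :: "complex^'n^'n"
  shows "map_matrix (\<lambda>a. [:a:]) (A ** B) = map_matrix (\<lambda>a. [:a:]) A ** map_matrix (\<lambda>a. [:a:]) B"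
proof -
  have "[:\<Sum>i\<in>I. f i:] = (\<Sum>i\<in>I. [:f i:])" for f :: "'n \<Rightarrow> complex" and I
    by (induction I rule: infinite_finite_induct) (simp_all, metis add_pCons add.right_neutral)
  thus ?thesis by (simp add: vec_eq_iff matrix_matrix_mult_def map_matrix_def mult.commute)
qed

lemma matrix_diff_ldistrib: "A ** (B - C) = A ** B - A ** C" for A :: "'a::ring_1^'n^'m"
  by (simp add: matrix_matrix_mult_def vec_eq_iff right_diff_distrib sum_subtractf)

lemma matrix_diff_rdistrib: "(A - B) ** C = A ** C - B ** C" for A :: "'a::ring_1^'n^'m"
  by (simp add: matrix_matrix_mult_def vec_eq_iff left_diff_distrib sum_subtractf)

lemma charpoly_unitary_conj:
  fixes U :: "complex^'n^'n"
  assumes "unitary U"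
  shows "charpoly (U ** diag_mat d ** ctranspose U) = (\<Prod>i\<in>UNIV. [:- d i, 1:])"
proof -
  let ?c = "map_matrix (\<lambda>a. [:a:]) :: complex^'n^'n \<Rightarrow> complex poly^'n^'n"
  let ?X = "mat [:0, 1:] :: complex poly^'n^'n"
  have one: "?c (mat 1) = mat 1" by (simp add: vec_eq_iff map_matrix_def mat_def one_pCons)
  have comm: "?X ** M = M ** ?X" for M
    by (simp add: vec_eq_iff matrix_matrix_mult_def mat_def if_distrib[of "\<lambda>x. x * _"]
        if_distrib[of "\<lambda>x. _ * x"] mult.commute cong: if_cong)
  have inv: "?c U ** ?c (ctranspose U) = mat 1"
    using unitary_right[OF assms] one by (metis map_matrix_mult_const_poly)
  have "?c U ** (?X - ?c (diag_mat d)) ** ?c (ctranspose U)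
      = ?c U ** ?X ** ?c (ctranspose U) - ?c U ** ?c (diag_mat d) ** ?c (ctranspose U)"
    by (simp only: matrix_diff_ldistrib matrix_diff_rdistrib)
  also have "?c U ** ?X ** ?c (ctranspose U) = ?X"
    using inv by (simp add: comm[symmetric] flip: matrix_mul_assoc)
  finally have "charpoly (U ** diag_mat d ** ctranspose U)
      = det (?c U ** (?X - ?c (diag_mat d)) ** ?c (ctranspose U))"
    by (simp add: charpoly_def map_matrix_mult_const_poly)
  also have "\<dots> = det (?c U ** ?c (ctranspose U)) * det (?X - ?c (diag_mat d))"
    by (simp add: det_mul mult_ac)
  also have "\<dots> = det (?X - ?c (diag_mat d))" by (simp add: inv)
  also have "\<dots> = (\<Prod>i\<in>UNIV. [:- d i, 1:])"
    by (subst det_diagonal) (auto simp: mat_def diag_mat_def map_matrix_def)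
  finally show ?thesis .
qed

lemma minor_sum_psd:
  fixes A :: "complex^'n^'n"
  assumes "unitary U" "A = U ** diag_mat (\<lambda>i. of_real (d i)) ** ctranspose U"
  shows "minor_sum k A = of_real (elem_sym k d)"
  unfolding assms(2) by (simp add: minor_sum_unitary_conj[OF assms(1)] minor_sum_diag_mat elem_sym_of_real)

text \<open>Replaces an expression in chosen eigenvalues by a polynomial in the entries, as required
  for holomorphy and Cauchy-Binet.\<close>

lemma trace_k_eq_minor_sum:
  fixes A :: "complex^'n^'n"
  assumes "A \<in> psd_cone"
  shows "trace_k k A = minor_sum k A"
proof -
  obtain U d where U: "unitary U" and A: "A = U ** diag_mat (\<lambda>i. of_real (d i)) ** ctranspose U"
    using hermitian_diagonalization[OF psd_cone_hermitian[OF assms]] by blast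
  have "(\<Prod>i\<in>UNIV. [:- eigenvals A i, 1:]) = (\<Prod>i\<in>UNIV. [:- complex_of_real (d i), 1:])"
    using charpoly_eigenvals[of A] charpoly_unitary_conj[OF U, of "\<lambda>i. of_real (d i)"] A by simp
  hence "elem_sym k (eigenvals A) = elem_sym k (\<lambda>i. complex_of_real (d i))"
    by (rule elem_sym_charpoly_unique)
  thus ?thesis by (simp add: trace_k_def minor_sum_psd[OF U A] elem_sym_of_real)
qed

subsection \<open>Concavity of roots of elementary symmetric polynomials\<close>

text \<open>The index set is a parameter because the recursions delete one index at a time.\<close>

definition esym :: "nat \<Rightarrow> 'a set \<Rightarrow> ('a \<Rightarrow> real) \<Rightarrow> real" where
  "esym k S x = (\<Sum>I | I \<subseteq> S \<and> card I = k. \<Prod>i\<in>I. x i)"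

lemma esym_nonneg: "(\<And>i. i \<in> S \<Longrightarrow> 0 \<le> x i) \<Longrightarrow> 0 \<le> esym k S x"
  unfolding esym_def by (intro sum_nonneg prod_nonneg) auto

lemma esym_0: "finite S \<Longrightarrow> esym 0 S x = 1"
proof -
  assume "finite S"
  hence "{I. I \<subseteq> S \<and> card I = 0} = {{}}" by (auto dest: finite_subset)
  thus ?thesis by (simp add: esym_def)
qed

lemma esym_mono:
  "(\<And>i. i \<in> S \<Longrightarrow> 0 \<le> x i) \<Longrightarrow> (\<And>i. i \<in> S \<Longrightarrow> x i \<le> y i) \<Longrightarrow> esym k S x \<le> esym k S y"
  unfolding esym_def by (intro sum_mono prod_mono) auto

lemma esym_scale: "esym k S (\<lambda>i. c * x i) = c ^ k * esym k S x"
  unfolding esym_def sum_distrib_left by (intro sum.cong) (auto simp: prod.distrib)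

lemma esym_Suc:
  assumes S: "finite S" and i: "i \<in> S"
  shows "esym (Suc k) S x = x i * esym k (S - {i}) x + esym (Suc k) (S - {i}) x"
proof -
  let ?A = "{I. I \<subseteq> S \<and> card I = Suc k \<and> i \<in> I}"
  let ?B = "{I. I \<subseteq> S - {i} \<and> card I = Suc k}"
  have fin: "finite ?A" "finite ?B" using S by (auto intro: finite_subset[of _ "Pow S"])
  have AB: "{I. I \<subseteq> S \<and> card I = Suc k} = ?A \<union> ?B" "?A \<inter> ?B = {}" by auto
  have b: "bij_betw (insert i) {I. I \<subseteq> S - {i} \<and> card I = k} ?A"
  proof (rule bij_betw_byWitness[where f' = "\<lambda>I. I - {i}"])
    show "insert i ` {I. I \<subseteq> S - {i} \<and> card I = k} \<subseteq> ?A"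
    proof clarify
      fix I assume "I \<subseteq> S - {i}" "k = card I"
      moreover from this have "finite I" "i \<notin> I" using S by (auto intro: finite_subset)
      ultimately show "insert i I \<subseteq> S \<and> card (insert i I) = Suc (card I) \<and> i \<in> insert i I"
        using i by auto
    qed
    show "(\<lambda>I. I - {i}) ` ?A \<subseteq> {I. I \<subseteq> S - {i} \<and> card I = k}"
      using S by (auto simp: card_Diff_singleton dest: finite_subset)
  qed (use i in auto)
  have "(\<Sum>I\<in>?A. \<Prod>i\<in>I. x i) = (\<Sum>I | I \<subseteq> S - {i} \<and> card I = k. \<Prod>j\<in>insert i I. x j)"
    by (rule sum.reindex_bij_betw[OF b, symmetric])
  also have "\<dots> = x i * esym k (S - {i}) x"
    unfolding esym_def sum_distrib_left
  proof (rule sum.cong[OF refl])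
    fix I assume "I \<in> {I. I \<subseteq> S - {i} \<and> card I = k}"
    hence "finite I" "i \<notin> I" using S by (auto dest: finite_subset)
    thus "(\<Prod>j\<in>insert i I. x j) = x i * prod x I" by simp
  qed
  finally show ?thesis
    unfolding esym_def[of "Suc k" S] AB(1) sum.union_disjoint[OF fin AB(2)] by (simp add: esym_def)
qed

text \<open>Euler's identity for a homogeneous polynomial: \<open>esym k (S - {i}) x\<close> is the
  partial derivative of \<open>esym (Suc k) S x\<close> in the variable i.\<close>

lemma esym_Euler:
  assumes S: "finite S"
  shows "(\<Sum>i\<in>S. x i * esym k (S - {i}) x) = real (Suc k) * esym (Suc k) S x"
proof -
  let ?P = "{I. I \<subseteq> S \<and> card I = Suc k}"
  have fin: "finite ?P" using S by (auto intro: finite_subset[of _ "Pow S"])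
  have "(\<Sum>i\<in>S. x i * esym k (S - {i}) x) = (\<Sum>i\<in>S. esym (Suc k) S x - esym (Suc k) (S - {i}) x)"
    by (intro sum.cong refl) (simp add: esym_Suc[OF S])
  also have "\<dots> = (\<Sum>i\<in>S. \<Sum>I\<in>?P. if i \<in> I then prod x I else 0)"
  proof (rule sum.cong[OF refl])
    fix i assume "i \<in> S"
    have "{I. I \<subseteq> S - {i} \<and> card I = Suc k} = {I \<in> ?P. i \<notin> I}" by auto
    hence "esym (Suc k) (S - {i}) x = (\<Sum>I\<in>?P. if i \<notin> I then prod x I else 0)"
      unfolding esym_def using sum.inter_filter[OF fin, of "prod x" "\<lambda>I. i \<notin> I"] by simp
    thus "esym (Suc k) S x - esym (Suc k) (S - {i}) x = (\<Sum>I\<in>?P. if i \<in> I then prod x I else 0)"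
      unfolding esym_def[of "Suc k" S]
      by (simp flip: sum_subtractf) (intro sum.cong, auto)
  qed
  also have "\<dots> = (\<Sum>I\<in>?P. \<Sum>i\<in>S. if i \<in> I then prod x I else 0)" by (rule sum.swap)
  also have "\<dots> = (\<Sum>I\<in>?P. real (Suc k) * prod x I)"
  proof (rule sum.cong[OF refl])
    fix I assume I: "I \<in> ?P"
    hence "{i \<in> S. i \<in> I} = I" by auto
    thus "(\<Sum>i\<in>S. if i \<in> I then prod x I else 0) = real (Suc k) * prod x I"
      using I sum.inter_filter[OF S, of "\<lambda>_. prod x I" "\<lambda>i. i \<in> I"] by simp
  qed
  finally show ?thesis by (simp add: esym_def sum_distrib_left)
qed

text \<open>The resistance of two parallel resistors; since x / 0 = 0, \<open>parallel 0 0\<close>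
  is 0.\<close>

definition parallel :: "real \<Rightarrow> real \<Rightarrow> real" where
  "parallel a b = a * b / (a + b)"

text \<open>After clearing denominators the defect is the square (a d - b c)^2.\<close>

lemma parallel_superadditive:
  assumes "0 \<le> a" "0 \<le> b" "0 \<le> c" "0 \<le> d"
  shows "parallel a b + parallel c d \<le> parallel (a + c) (b + d)"
proof (cases "a + b = 0 \<or> c + d = 0")
  case True
  thus ?thesis using assms by (auto simp: parallel_def add_nonneg_eq_0_iff)
next
  case False
  hence p: "0 < a + b" "0 < c + d" "0 < a + c + (b + d)" using assms by linarith+
  have "(a + c) * (b + d) * ((a + b) * (c + d)) - (a * b * (c + d) + c * d * (a + b)) * (a + c + (b + d))
      = (a * d - b * c)\<^sup>2"
    by (simp add: power2_eq_square algebra_simps)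
  hence "(a * b * (c + d) + c * d * (a + b)) * (a + c + (b + d)) \<le> (a + c) * (b + d) * ((a + b) * (c + d))"
    by (smt (verit) zero_le_power2)
  thus ?thesis using p unfolding parallel_def
    by (simp add: add_frac_eq divide_le_eq le_divide_eq mult_ac)
qed

lemma parallel_mono:
  assumes "0 \<le> a" "0 \<le> b" "b \<le> c"
  shows "parallel a b \<le> parallel a c"
proof (cases "a + b = 0")
  case True
  thus ?thesis using assms by (auto simp: parallel_def)
next
  case False
  hence p: "0 < a + b" "0 < a + c" using assms by linarith+
  have "a * b * (a + c) \<le> a * c * (a + b)"
    using assms mult_left_mono[OF assms(3), of "a * a"] by (simp add: algebra_simps)
  thus ?thesis using p by (simp add: parallel_def divide_le_eq le_divide_eq mult_ac)
qed

text \<open>Settles the degenerate quotients: a vanishing denominator forces a vanishing numerator,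
  because every term of Euler's sum is then zero.\<close>

lemma esym_Suc_eq_0:
  assumes S: "finite S" and x: "\<And>i. i \<in> S \<Longrightarrow> 0 \<le> x i" and z: "esym k S x = 0"
  shows "esym (Suc k) S x = 0"
proof -
  have "esym k (S - {i}) x = 0" if "i \<in> S" for i
  proof -
    have "esym k (S - {i}) x \<le> esym k S x"
      unfolding esym_def using S x by (intro sum_mono2 prod_nonneg) (auto intro: finite_subset[of _ "Pow S"])
    moreover have "0 \<le> esym k (S - {i}) x" using x by (intro esym_nonneg) auto
    ultimately show ?thesis using z by simp
  qed
  hence "real (Suc k) * esym (Suc k) S x = 0" unfolding esym_Euler[OF S, symmetric] by simp
  thus ?thesis by simp
qed

text \<open>Marcus and Lopes: the quotient of consecutive elementary symmetric polynomials is
  superadditive, because it is a sum of parallel sums of \<open>x i\<close> with quotients of lower order.\<close>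

definition esym_ratio :: "nat \<Rightarrow> 'a set \<Rightarrow> ('a \<Rightarrow> real) \<Rightarrow> real" where
  "esym_ratio k S x = esym (Suc k) S x / esym k S x"

lemma esym_ratio_nonneg: "(\<And>i. i \<in> S \<Longrightarrow> 0 \<le> x i) \<Longrightarrow> 0 \<le> esym_ratio k S x"
  unfolding esym_ratio_def by (intro divide_nonneg_nonneg esym_nonneg)

text \<open>Euler's identity expands the numerator over i; dividing each term by
  \<open>esym (Suc k) S x\<close>, split according to whether i occurs, produces a parallel
  sum.\<close>

lemma esym_ratio_Suc:
  assumes S: "finite S" and x: "\<And>i. i \<in> S \<Longrightarrow> 0 \<le> x i"
  shows "esym_ratio (Suc k) S x
    = (\<Sum>i\<in>S. parallel (x i) (esym_ratio k (S - {i}) x)) / real (Suc (Suc k))"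
proof -
  have "x i * esym (Suc k) (S - {i}) x / esym (Suc k) S x = parallel (x i) (esym_ratio k (S - {i}) x)"
    if i: "i \<in> S" for i
  proof -
    let ?u = "esym k (S - {i}) x" and ?v = "esym (Suc k) (S - {i}) x"
    have u: "0 \<le> ?u" and v: "0 \<le> ?v" using x by (auto intro!: esym_nonneg)
    have e: "esym (Suc k) S x = x i * ?u + ?v" by (rule esym_Suc[OF S i])
    show ?thesis
    proof (cases "?u = 0")
      case True
      hence "?v = 0" using S x by (intro esym_Suc_eq_0) auto
      thus ?thesis by (simp add: parallel_def esym_ratio_def)
    next
      case False
      hence "x i + ?v / ?u = (x i * ?u + ?v) / ?u" by (simp add: field_simps)
      thus ?thesis using False unfolding e parallel_def esym_ratio_def by simp
    qed
  qed
  hence "(\<Sum>i\<in>S. parallel (x i) (esym_ratio k (S - {i}) x))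
      = (\<Sum>i\<in>S. x i * esym (Suc k) (S - {i}) x) / esym (Suc k) S x"
    unfolding sum_divide_distrib by (intro sum.cong refl) simp
  thus ?thesis
    unfolding esym_Euler[OF S] esym_ratio_def by simp
qed

lemma esym_ratio_superadditive:
  assumes "finite S" "\<And>i. i \<in> S \<Longrightarrow> 0 \<le> x i" "\<And>i. i \<in> S \<Longrightarrow> 0 \<le> y i"
  shows "esym_ratio k S x + esym_ratio k S y \<le> esym_ratio k S (\<lambda>i. x i + y i)"
  using assms
proof (induction k arbitrary: S)
  case 0
  have "esym 1 S x = (\<Sum>i\<in>S. x i)" for x
    using esym_Euler[OF 0(1), of x 0] by (simp add: esym_0 0(1))
  thus ?case by (simp add: esym_ratio_def esym_0 0(1) sum.distrib)
next
  case (Suc k)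
  have "parallel (x i) (esym_ratio k (S - {i}) x) + parallel (y i) (esym_ratio k (S - {i}) y)
      \<le> parallel (x i + y i) (esym_ratio k (S - {i}) (\<lambda>i. x i + y i))" if "i \<in> S" for i
  proof (rule order_trans[OF parallel_superadditive parallel_mono])
    show "esym_ratio k (S - {i}) x + esym_ratio k (S - {i}) y \<le> esym_ratio k (S - {i}) (\<lambda>i. x i + y i)"
      using Suc.prems by (intro Suc.IH) auto
  qed (use Suc.prems that in \<open>auto intro!: esym_ratio_nonneg add_nonneg_nonneg\<close>)
  hence "(\<Sum>i\<in>S. parallel (x i) (esym_ratio k (S - {i}) x)) + (\<Sum>i\<in>S. parallel (y i) (esym_ratio k (S - {i}) y))
      \<le> (\<Sum>i\<in>S. parallel (x i + y i) (esym_ratio k (S - {i}) (\<lambda>i. x i + y i)))"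
    unfolding sum.distrib[symmetric] by (rule sum_mono)
  thus ?case
    using Suc.prems by (simp add: esym_ratio_Suc divide_right_mono flip: add_divide_distrib)
qed

section \<open>Hoelder's inequality and superadditivity of the roots\<close>

lemma Young_nonneg:
  fixes u v :: real
  assumes "0 \<le> u" "0 \<le> v" "0 \<le> \<alpha>" "0 \<le> \<beta>" "\<alpha> + \<beta> = 1"
  shows "u powr \<alpha> * v powr \<beta> \<le> \<alpha> * u + \<beta> * v"
  using assms Youngs_inequality_0[of \<alpha> \<beta> u v] by (cases "u = 0 \<or> v = 0") auto

text \<open>Hoelder for two terms: Young's inequality is applied to the fractions of the totals, and
  the resulting arithmetic means add up to \<alpha> + \<beta> = 1.\<close>

lemma powr_mean_superadditive:
  fixes a b c d :: real
  assumes "0 \<le> a" "0 \<le> b" "0 \<le> c" "0 \<le> d" "0 \<le> \<alpha>" "0 \<le> \<beta>" "\<alpha> + \<beta> = 1"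
  shows "a powr \<alpha> * b powr \<beta> + c powr \<alpha> * d powr \<beta> \<le> (a + c) powr \<alpha> * (b + d) powr \<beta>"
proof (cases "a + c = 0 \<or> b + d = 0")
  case True
  thus ?thesis using assms by (auto simp: add_nonneg_eq_0_iff)
next
  case False
  hence p: "0 < a + c" "0 < b + d" using assms by linarith+
  let ?G = "(a + c) powr \<alpha> * (b + d) powr \<beta>"
  have "(a / (a + c)) powr \<alpha> * (b / (b + d)) powr \<beta> + (c / (a + c)) powr \<alpha> * (d / (b + d)) powr \<beta>
      \<le> (\<alpha> * (a / (a + c)) + \<beta> * (b / (b + d))) + (\<alpha> * (c / (a + c)) + \<beta> * (d / (b + d)))"
    using assms p by (intro add_mono Young_nonneg) auto
  also have "\<dots> = \<alpha> * ((a + c) / (a + c)) + \<beta> * ((b + d) / (b + d))"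
    by (simp only: add_divide_distrib distrib_left add_ac)
  also have "\<dots> = 1" using p assms(7) by simp
  finally have *: "(a powr \<alpha> * b powr \<beta> + c powr \<alpha> * d powr \<beta>) / ?G \<le> 1"
    using assms p by (simp add: powr_divide add_divide_distrib)
  have "?G > 0" using p by simp
  thus ?thesis using * by (simp add: divide_le_eq)
qed

text \<open>The root of order k + 2 is the geometric mean of the ratio, with weight 1/(k + 2), and
  the previous root, with weight (k + 1)/(k + 2); both are superadditive.\<close>

lemma esym_root_superadditive:
  assumes S: "finite S" and x: "\<And>i. i \<in> S \<Longrightarrow> 0 \<le> x i" and y: "\<And>i. i \<in> S \<Longrightarrow> 0 \<le> y i"
  shows "esym (Suc k) S x powr (1 / real (Suc k)) + esym (Suc k) S y powr (1 / real (Suc k))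
    \<le> esym (Suc k) S (\<lambda>i. x i + y i) powr (1 / real (Suc k))"
proof (induction k)
  case 0
  have "esym 1 S x = (\<Sum>i\<in>S. x i)" for x
    using esym_Euler[OF S, of x 0] by (simp add: esym_0 S)
  thus ?case using x y by (simp add: sum.distrib sum_nonneg)
next
  case (Suc k)
  let ?\<beta> = "real (Suc k) / real (Suc (Suc k))" and ?\<alpha> = "1 / real (Suc (Suc k))"
  let ?g = "\<lambda>x. esym (Suc k) S x powr (1 / real (Suc k))"
  have split: "esym (Suc (Suc k)) S z powr ?\<alpha> = esym_ratio (Suc k) S z powr ?\<alpha> * ?g z powr ?\<beta>"
    if z: "\<And>i. i \<in> S \<Longrightarrow> 0 \<le> z i" for z
  proof (cases "esym (Suc k) S z = 0")
    case True
    thus ?thesis using esym_Suc_eq_0[OF S z True] by simp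
  next
    case False
    have n: "0 \<le> esym (Suc k) S z" "0 \<le> esym (Suc (Suc k)) S z" using z by (auto intro!: esym_nonneg)
    have "?g z powr ?\<beta> = esym (Suc k) S z powr ?\<alpha>" by (simp add: powr_powr)
    thus ?thesis using n False by (simp add: esym_ratio_def powr_divide)
  qed
  have xy: "\<And>i. i \<in> S \<Longrightarrow> 0 \<le> x i + y i" using x y by (simp add: add_nonneg_nonneg)
  note split_x = split[of x, OF x] and split_y = split[of y, OF y]
    and split_xy = split[of "\<lambda>i. x i + y i", OF xy]
  have "esym_ratio (Suc k) S x powr ?\<alpha> * ?g x powr ?\<beta> + esym_ratio (Suc k) S y powr ?\<alpha> * ?g y powr ?\<beta>
      \<le> (esym_ratio (Suc k) S x + esym_ratio (Suc k) S y) powr ?\<alpha> * (?g x + ?g y) powr ?\<beta>"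
    using x y by (intro powr_mean_superadditive esym_ratio_nonneg) (auto simp: field_simps)
  also have "\<dots> \<le> esym_ratio (Suc k) S (\<lambda>i. x i + y i) powr ?\<alpha> * ?g (\<lambda>i. x i + y i) powr ?\<beta>"
    using x y Suc.IH esym_ratio_superadditive[OF S x y, where k = "Suc k"]
    by (intro mult_mono powr_mono2 add_nonneg_nonneg esym_ratio_nonneg) auto
  finally show ?case by (simp only: split_x split_y split_xy)
qed

lemma elem_sym_eq_esym: "elem_sym k x = esym k UNIV x"
  by (simp add: elem_sym_def esym_def)

lemma elem_sym_root_concave:
  fixes x y z :: "'n::finite \<Rightarrow> real"
  assumes "1 \<le> k" "\<And>i. 0 \<le> x i" "\<And>i. 0 \<le> y i" "0 \<le> a" "0 \<le> b" "\<And>i. a * x i + b * y i \<le> z i"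
  shows "a * elem_sym k x powr (1 / real k) + b * elem_sym k y powr (1 / real k)
    \<le> elem_sym k z powr (1 / real k)"
proof -
  obtain m where k: "k = Suc m" using assms(1) by (cases k) auto
  have s: "c * esym k UNIV u powr (1 / real k) = esym k UNIV (\<lambda>i. c * u i) powr (1 / real k)"
    if "0 \<le> c" "\<And>i. 0 \<le> u i" for c and u :: "'n \<Rightarrow> real"
  proof (cases "c = 0")
    case True
    thus ?thesis using esym_scale[of k UNIV 0 u] by (simp add: k)
  next
    case False
    hence "c ^ k = c powr real k" using that by (simp add: powr_realpow)
    hence "(c ^ k) powr (1 / real k) = c"
      using that k False by (simp only: powr_powr) simp
    thus ?thesis using that by (simp add: esym_scale powr_mult esym_nonneg)
  qed
  have "a * elem_sym k x powr (1 / real k) + b * elem_sym k y powr (1 / real k)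
      \<le> esym k UNIV (\<lambda>i. a * x i + b * y i) powr (1 / real k)"
    using assms esym_root_superadditive[of UNIV "\<lambda>i. a * x i" "\<lambda>i. b * y i" m]
    by (simp add: s elem_sym_eq_esym flip: k)
  also have "\<dots> \<le> esym k UNIV z powr (1 / real k)"
    using assms by (intro powr_mono2 esym_mono esym_nonneg) auto
  finally show ?thesis by (simp add: elem_sym_eq_esym)
qed


subsection \<open>Hadamard's inequality\<close>

lemma det_psd:
  fixes A :: "complex^'n^'n"
  assumes "unitary U" "A = U ** diag_mat (\<lambda>i. of_real (d i)) ** ctranspose U"
  shows "det A = of_real (\<Prod>i\<in>UNIV. d i)"
proof -
  have "det U * det (ctranspose U) = 1"
    using unitary_right[OF assms(1)] by (metis det_I det_mul)
  moreover have "det (diag_mat (\<lambda>i. of_real (d i)) :: complex^'n^'n) = (\<Prod>i\<in>UNIV. of_real (d i))"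
    by (subst det_diagonal) (auto simp: diag_mat_def)
  ultimately show ?thesis unfolding assms(2) by (simp add: det_mul mult_ac)
qed

lemma trace_unitary_conj:
  fixes U M :: "complex^'n^'n"
  assumes "unitary U"
  shows "trace (U ** M ** ctranspose U) = trace M"
  using assms trace_mul_sym[of "U ** M" "ctranspose U"] by (simp add: matrix_mul_assoc unitary_def)

text \<open>Arithmetic-geometric mean for the eigenvalues, in the form x \<le> exp (x - 1): the
  exponents add up to trace minus dimension, which is 0.\<close>

lemma Hadamard_unit_diagonal:
  fixes A :: "complex^'n^'n"
  assumes A: "A \<in> psd_cone" and d1: "\<And>i. A $ i $ i = 1"
  shows "Re (det A) \<le> 1"
proof (rule cpow_diagE[OF A], goal_cases)
  case (1 U d)
  have "complex_of_real (\<Sum>i\<in>UNIV. d i) = trace A"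
    unfolding 1(2) trace_unitary_conj[OF 1(1)] by (simp add: trace_def diag_mat_def)
  also have "\<dots> = of_real (real CARD('n))" by (simp add: trace_def d1)
  finally have s: "(\<Sum>i\<in>UNIV. d i) = real CARD('n)" unfolding of_real_eq_iff .
  have "(\<Prod>i\<in>UNIV. d i) \<le> (\<Prod>i\<in>(UNIV::'n set). exp (d i - 1))"
    using 1(3) exp_ge_add_one_self[of "d i - 1" for i] by (intro prod_mono) auto
  also have "\<dots> = exp (\<Sum>i\<in>UNIV. (d i - 1))" by (simp add: exp_sum)
  also have "\<dots> = 1" by (simp add: sum_subtractf s)
  finally show ?case unfolding det_psd[OF 1(1,2)] Re_complex_of_real .
qed

lemma psd_diag_nonneg: "A \<in> psd_cone \<Longrightarrow> 0 \<le> Re (A $ i $ i)"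
  using psd_cone_qf[of A "axis i 1"] by (simp add: qf_axis)

lemma psd_diag_real: "A \<in> psd_cone \<Longrightarrow> A $ i $ i = of_real (Re (A $ i $ i))"
  using psd_cone_hermitian[of A] ctranspose_nth[of A i i]
  by (metis Reals_cnj_iff of_real_Re)

text \<open>A zero diagonal entry annihilates its column; otherwise a diagonal congruence normalises
  the diagonal to 1.\<close>

theorem Hadamard_det:
  fixes A :: "complex^'n^'n"
  assumes A: "A \<in> psd_cone"
  shows "Re (det A) \<le> (\<Prod>i\<in>UNIV. Re (A $ i $ i))"
proof (cases "\<exists>i. A $ i $ i = 0")
  case True
  then obtain i where i: "A $ i $ i = 0" by blast
  let ?S = "cpow A (of_real (1 / 2))"
  have g: "ctranspose ?S ** ?S = A" using cpow_gram[OF A, of "of_real (1 / 2)"] by (simp add: cpow_one A)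
  have "(norm (?S *v axis i 1))\<^sup>2 = 0"
    using qf_gram[of ?S "axis i 1"] i unfolding g qf_axis by simp
  hence "A *v axis i 1 = 0" using g by (metis matrix_vector_mul_assoc matrix_vector_mult_0_right norm_eq_zero power_eq_0_iff)
  moreover have "A *v axis i 1 = column i A"
    by (simp add: vec_eq_iff matrix_vector_mult_def axis_def column_def
        if_distrib[of "\<lambda>x. _ * x"] cong: if_cong)
  ultimately have "column i A = 0" by simp
  hence "det A = 0" by (rule det_zero_column)
  thus ?thesis using A by (simp add: prod_nonneg psd_diag_nonneg)
next
  case False
  define c where "c i = 1 / sqrt (Re (A $ i $ i))" for i
  let ?D = "diag_mat (\<lambda>i. of_real (c i)) :: complex^'n^'n"
  have pos: "0 < Re (A $ i $ i)" for i
    using False psd_diag_nonneg[OF A, of i] psd_diag_real[OF A, of i] by (metis less_eq_real_def of_real_0)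
  have cc: "c i * c i * Re (A $ i $ i) = 1" for i
    using pos[of i] by (simp add: c_def)
  have ct: "ctranspose ?D = ?D" by (simp add: ctranspose_diag_mat)
  have "(?D ** A ** ?D) $ i $ i = 1" for i
  proof -
    have "(?D ** A ** ?D) $ i $ i = of_real (c i) * A $ i $ i * of_real (c i)"
      by (simp add: diag_mat_mult_left diag_mat_mult_right)
    also have "\<dots> = of_real (c i * c i * Re (A $ i $ i))"
      by (subst psd_diag_real[OF A]) simp
    finally show ?thesis by (simp only: cc of_real_1)
  qed
  moreover have "?D ** A ** ?D \<in> psd_cone" using psd_cone_congruence[OF A, of ?D] by (simp add: ct)
  ultimately have "Re (det (?D ** A ** ?D)) \<le> 1" by (intro Hadamard_unit_diagonal)
  moreover define p where "p = (\<Prod>i\<in>UNIV. c i)"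
  have "det ?D = of_real p"
    unfolding p_def by (subst det_diagonal) (auto simp: diag_mat_def)
  hence "det (?D ** A ** ?D) = of_real (p * p) * det A"
    by (simp add: det_mul mult_ac)
  ultimately have *: "p * p * Re (det A) \<le> 1" by simp
  have "p * p * (\<Prod>i\<in>UNIV. Re (A $ i $ i)) = 1"
    unfolding p_def by (simp add: cc flip: prod.distrib)
  moreover have "0 < p * p"
    unfolding p_def using pos by (intro mult_pos_pos prod_pos) (auto simp: c_def)
  ultimately show ?thesis
    using * mult_le_cancel_left_pos[of "p * p" "Re (det A)" "\<Prod>i\<in>UNIV. Re (A $ i $ i)"] by simp
qed

text \<open>The principal submatrix on \<open>I\<close>, completed by an identity block, so that its
  minor becomes a determinant over the same index type.\<close>

definition pad :: "'n set \<Rightarrow> complex^'n^'n \<Rightarrow> complex^'n^'n" where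
  "pad I A = (\<chi> i j. if i \<in> I \<and> j \<in> I then A $ i $ j else if i = j then 1 else 0)"

lemma psd_cone_pad:
  fixes A :: "complex^'n^'n"
  assumes A: "A \<in> psd_cone"
  shows "pad I A \<in> psd_cone"
proof -
  let ?E = "diag_mat (\<lambda>i. if i \<in> I then 1 else 0) :: complex^'n^'n"
  let ?F = "diag_mat (\<lambda>i. if i \<in> I then 0 else 1) :: complex^'n^'n"
  have "pad I A = 1 *\<^sub>R (ctranspose ?E ** A ** ?E) + 1 *\<^sub>R (ctranspose ?F ** ?F)"
    unfolding ctranspose_diag_mat by (simp add: vec_eq_iff diag_mat_mult_left diag_mat_mult_right)
      (simp add: pad_def diag_mat_def)
  thus ?thesis
    using psd_cone_combine[OF psd_cone_congruence[OF A, of ?E] psd_cone_gram[of ?F], of 1 1] by simp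
qed

lemma minor_eq_det_pad:
  fixes A :: "complex^'n^'n"
  assumes f: "inj_on f {..<k}"
  shows "minor k A f f = det (pad (f ` {..<k}) A)"
proof -
  let ?I = "f ` {..<k}"
  let ?t = "\<lambda>p. of_int (sign p) * (\<Prod>i\<in>UNIV. pad ?I A $ i $ p i)"
  have "det (pad ?I A) = (\<Sum>p | p permutes ?I. ?t p)"
    unfolding det_def
  proof (rule sum.mono_neutral_right)
    show "finite {p. p permutes (UNIV :: 'n set)}" by (simp add: finite_permutations)
    show "{p. p permutes ?I} \<subseteq> {p. p permutes UNIV}" using permutes_subset by blast
    show "\<forall>p\<in>{p. p permutes UNIV} - {p. p permutes ?I}. ?t p = 0"
    proof
      fix p assume p: "p \<in> {p. p permutes UNIV} - {p. p permutes ?I}"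
      hence "bij p" using permutes_bij by blast
      \<comment> \<open>A bijection that is not a permutation of the image moves some index outside
        it and meets an off-diagonal zero of the padding.\<close>
      with p obtain i where "i \<notin> ?I" "p i \<noteq> i" unfolding permutes_def bij_iff by blast
      hence "pad ?I A $ i $ p i = 0" by (simp add: pad_def)
      thus "?t p = 0" by (simp, intro exI[of _ i])
    qed
  qed
  also have "\<dots> = (\<Sum>p | p permutes ?I. of_int (sign p) * (\<Prod>i\<in>?I. A $ i $ p i))"
  proof (rule sum.cong[OF refl])
    fix p assume "p \<in> {p. p permutes ?I}"
    hence p: "p permutes ?I" by simp
    have "(\<Prod>i\<in>UNIV. pad ?I A $ i $ p i) = (\<Prod>i\<in>?I. pad ?I A $ i $ p i)"
      using p by (intro prod.mono_neutral_right) (auto simp: pad_def permutes_not_in)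
    also have "\<dots> = (\<Prod>i\<in>?I. A $ i $ p i)"
      using permutes_in_image[OF p] by (intro prod.cong refl) (simp add: pad_def)
    finally show "?t p = of_int (sign p) * (\<Prod>i\<in>?I. A $ i $ p i)" by simp
  qed
  also have "\<dots> = (\<Sum>p | p permutes {..<k}. of_int (sign (map_permutation {..<k} f p))
      * (\<Prod>i\<in>?I. A $ i $ map_permutation {..<k} f p i))"
  proof (rule sum.reindex_bij_betw[symmetric])
    show "bij_betw (map_permutation {..<k} f) {p. p permutes {..<k}} {p. p permutes ?I}"
      using bij_betw_permutations[OF inj_on_imp_bij_betw[OF f]]
      unfolding map_permutation_def[abs_def] restrict_id_def o_def .
  qed
  also have "\<dots> = minor k A f f"
    unfolding minor_def
  proof (rule sum.cong[OF refl])
    fix p assume "p \<in> {p. p permutes {..<k}}"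
    hence p: "p permutes {..<k}" by simp
    have "(\<Prod>i\<in>?I. A $ i $ map_permutation {..<k} f p i) = (\<Prod>j<k. A $ f j $ f (p j))"
      using f by (simp add: prod.reindex map_permutation_apply)
    thus "of_int (sign (map_permutation {..<k} f p)) * (\<Prod>i\<in>?I. A $ i $ map_permutation {..<k} f p i)
        = of_int (sign p) * (\<Prod>j<k. A $ f j $ f (p j))"
      using f p by (simp add: sign_map_permutation)
  qed
  finally show ?thesis by simp
qed

text \<open>Hadamard's inequality applied to every principal minor.\<close>

lemma minor_sum_le_diagonal:
  fixes A :: "complex^'n^'n"
  assumes A: "A \<in> psd_cone"
  shows "Re (minor_sum k A) \<le> elem_sym k (\<lambda>i. Re (A $ i $ i))"
proof -
  have "Re (minor k A f f) \<le> (\<Prod>j<k. Re (A $ f j $ f j))" if f: "inj_on f {..<k}" for f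
  proof -
    have "Re (minor k A f f) \<le> (\<Prod>i\<in>UNIV. Re (pad (f ` {..<k}) A $ i $ i))"
      unfolding minor_eq_det_pad[OF f] by (intro Hadamard_det psd_cone_pad A)
    also have "\<dots> = (\<Prod>i\<in>f ` {..<k}. Re (pad (f ` {..<k}) A $ i $ i))"
      by (intro prod.mono_neutral_right) (auto simp: pad_def)
    also have "\<dots> = (\<Prod>j<k. Re (A $ f j $ f j))"
      using f by (simp add: prod.reindex pad_def)
    finally show ?thesis .
  qed
  hence "(\<Sum>f | f \<in> index_maps k \<and> inj_on f {..<k}. Re (minor k A f f))
      \<le> (\<Sum>f | f \<in> index_maps k \<and> inj_on f {..<k}. \<Prod>j<k. Re (A $ f j $ f j))"
    by (intro sum_mono) auto
  also have "\<dots> = fact k * elem_sym k (\<lambda>i. Re (A $ i $ i))"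
    using sum_inj_index_maps[of "\<lambda>i. Re (A $ i $ i)" k] by simp
  finally have "(\<Sum>f | f \<in> index_maps k \<and> inj_on f {..<k}. Re (minor k A f f)) / fact k
      \<le> fact k * elem_sym k (\<lambda>i. Re (A $ i $ i)) / fact k"
    by (rule divide_right_mono) simp
  moreover have "Re (minor_sum k A) = (\<Sum>f | f \<in> index_maps k \<and> inj_on f {..<k}. Re (minor k A f f)) / fact k"
  proof -
    have "minor_sum k A = (\<Sum>f | f \<in> index_maps k \<and> inj_on f {..<k}. minor k A f f) / of_real (fact k)"
      by (simp add: minor_sum_inj)
    thus ?thesis by (simp only: Re_divide_of_real Re_sum)
  qed
  ultimately show ?thesis by simp
qed

lemma minor_sum_nonneg:
  fixes A :: "complex^'n^'n"
  assumes "A \<in> psd_cone"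
  shows "0 \<le> Re (minor_sum k A)"
proof (rule cpow_diagE[OF assms], goal_cases)
  case (1 U d)
  show ?case
    unfolding minor_sum_psd[OF 1(1,2)] using 1(3) by (simp add: elem_sym_eq_esym esym_nonneg)
qed

text \<open>In an orthonormal eigenbasis of \<open>R\<close> the diagonals of \<open>P\<close> and \<open>Q\<close> reduce the claim to vectors.\<close>

theorem minor_sum_root_concave:
  fixes P Q R :: "complex^'n^'n"
  assumes k: "1 \<le> k" and P: "P \<in> psd_cone" and Q: "Q \<in> psd_cone" and R: "R \<in> psd_cone"
    and a: "0 \<le> a" and b: "0 \<le> b"
    and le: "\<And>v. a * qf P v + b * qf Q v \<le> qf R v"
  shows "a * Re (minor_sum k P) powr (1 / real k) + b * Re (minor_sum k Q) powr (1 / real k)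
    \<le> Re (minor_sum k R) powr (1 / real k)"
proof (rule cpow_diagE[OF R], goal_cases)
  case (1 U d)
  let ?c = "\<lambda>M. ctranspose U ** M ** U"
  have inv: "minor_sum k (?c M) = minor_sum k M" for M
    using minor_sum_unitary_conj[OF unitary_ctranspose[OF 1(1)], of k M] by simp
  \<comment> \<open>Hadamard points the right way: passing to diagonals only enlarges the side of
    \<open>P\<close> and \<open>Q\<close>, while \<open>R\<close> is itself diagonal in this
    basis.\<close>
  have bound: "Re (minor_sum k M) powr (1 / real k) \<le> elem_sym k (\<lambda>i. Re (?c M $ i $ i)) powr (1 / real k)"
    if "M \<in> psd_cone" for M
    using minor_sum_le_diagonal[OF psd_cone_congruence[OF that], of k U] minor_sum_nonneg[OF that, of k]
    unfolding inv by (intro powr_mono2) auto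
  have qf: "Re (?c M $ i $ i) = qf M (U *v axis i 1)" for M i
    using qf_congruence[of U M "axis i 1"] by (simp add: qf_axis)
  have "?c R = (ctranspose U ** U) ** diag_mat (\<lambda>i. of_real (d i)) ** (ctranspose U ** U)"
    by (subst 1(2)) (simp only: matrix_mul_assoc)
  hence "?c R = diag_mat (\<lambda>i. of_real (d i))" using 1(1) by (simp add: unitary_def)
  hence d: "d i = qf R (U *v axis i 1)" for i
    unfolding qf[symmetric] by (simp add: diag_mat_def)
  have "a * Re (minor_sum k P) powr (1 / real k) + b * Re (minor_sum k Q) powr (1 / real k)
      \<le> a * elem_sym k (\<lambda>i. Re (?c P $ i $ i)) powr (1 / real k) + b * elem_sym k (\<lambda>i. Re (?c Q $ i $ i)) powr (1 / real k)"
    using a b by (intro add_mono mult_left_mono bound P Q)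
  also have "\<dots> \<le> elem_sym k d powr (1 / real k)"
    unfolding qf d using k a b le psd_cone_qf P Q by (intro elem_sym_root_concave) auto
  finally show ?case unfolding minor_sum_psd[OF 1(1,2)] by simp
qed

lemma minor_sum_mono:
  fixes P R :: "complex^'n^'n"
  assumes k: "1 \<le> k" and P: "P \<in> psd_cone" and R: "R \<in> psd_cone" and le: "\<And>v. qf P v \<le> qf R v"
  shows "Re (minor_sum k P) \<le> Re (minor_sum k R)"
proof -
  have "Re (minor_sum k P) powr (1 / real k) \<le> Re (minor_sum k R) powr (1 / real k)"
    using minor_sum_root_concave[OF k P P R, of 1 0] le by simp
  hence "(Re (minor_sum k P) powr (1 / real k)) powr real k \<le> (Re (minor_sum k R) powr (1 / real k)) powr real k"
    by (rule powr_mono2[rotated 2]) auto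
  thus ?thesis
    using minor_sum_nonneg[OF P, of k] minor_sum_nonneg[OF R, of k] k by (simp add: powr_powr)
qed

subsection \<open>The interpolating matrix functions\<close>

definition sandwich :: "complex^'n^'n \<Rightarrow> real \<Rightarrow> complex^'n^'n \<Rightarrow> complex^'n^'n" where
  "sandwich K r A = ctranspose K ** cpow A (of_real r) ** K"

text \<open>This is N with N* N = \<open>sandwich K r A\<close>. Hence |N|^t is
  \<open>cpow (sandwich K r A) (t / 2)\<close>, which accounts for the halved exponents
  below.\<close>

definition root_factor :: "complex^'n^'n \<Rightarrow> real \<Rightarrow> complex^'n^'n \<Rightarrow> complex^'n^'n" where
  "root_factor K r A = cpow A (of_real (r / 2)) ** K"

lemma sandwich_gram:
  assumes "A \<in> psd_cone"
  shows "ctranspose (root_factor K r A) ** root_factor K r A = sandwich K r A"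
proof -
  have "ctranspose (root_factor K r A) ** root_factor K r A
      = ctranspose K ** (ctranspose (cpow A (of_real (r / 2))) ** cpow A (of_real (r / 2))) ** K"
    unfolding root_factor_def ctranspose_mult by (simp only: matrix_mul_assoc)
  thus ?thesis by (simp add: cpow_gram[OF assms] sandwich_def)
qed

lemma psd_cone_sandwich: "A \<in> psd_cone \<Longrightarrow> sandwich K r A \<in> psd_cone"
  unfolding sandwich_def by (intro psd_cone_congruence psd_cone_cpow)

text \<open>N and |N| differ by a partial isometry on the left; comparing norms makes the polar
  decomposition itself unnecessary.\<close>

lemma norm_root_factor_cpow:
  assumes A: "A \<in> psd_cone"
  shows "norm ((root_factor K r A ** cpow (sandwich K r A) b) *v v)
    = norm (cpow (sandwich K r A) (b + of_real (1 / 2)) *v v)"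
proof -
  let ?M = "sandwich K r A"
  note M = psd_cone_sandwich[OF A, of K r]
  have g: "ctranspose (cpow ?M (of_real (1 / 2))) ** cpow ?M (of_real (1 / 2)) = ?M"
    using cpow_gram[OF M, of "of_real (1 / 2)"] by (simp add: cpow_one M)
  have "(norm ((root_factor K r A ** cpow ?M b) *v v))\<^sup>2 = qf ?M (cpow ?M b *v v)"
    using qf_gram[of "root_factor K r A" "cpow ?M b *v v"]
    by (simp add: sandwich_gram[OF A] matrix_vector_mul_assoc)
  also have "\<dots> = (norm (cpow ?M (b + of_real (1 / 2)) *v v))\<^sup>2"
    using qf_gram[of "cpow ?M (of_real (1 / 2))" "cpow ?M b *v v"]
    unfolding g by (simp add: matrix_vector_mul_assoc add.commute flip: cpow_add[OF M])
  finally show ?thesis by (simp add: power2_eq_iff_nonneg)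
qed

lemma cpow_sandwich_gram:
  assumes A: "A \<in> psd_cone"
  shows "(cpow (sandwich K r A) a ** ctranspose (root_factor K r A))
      ** ctranspose (cpow (sandwich K r A) a ** ctranspose (root_factor K r A))
    = cpow (sandwich K r A) (of_real (2 * Re a + 1))" (is "?W ** ctranspose ?W = _")
proof -
  let ?M = "sandwich K r A"
  note M = psd_cone_sandwich[OF A, of K r]
  have "?W ** ctranspose ?W
      = cpow ?M a ** (ctranspose (root_factor K r A) ** root_factor K r A) ** cpow ?M (cnj a)"
    unfolding ctranspose_mult ctranspose_ctranspose ctranspose_cpow[OF M]
    by (simp only: matrix_mul_assoc)
  also have "\<dots> = cpow ?M a ** cpow ?M 1 ** cpow ?M (cnj a)"
    by (simp add: sandwich_gram[OF A] cpow_one M)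
  also have "\<dots> = cpow ?M ((a + cnj a) + 1)"
    by (simp add: add_ac flip: cpow_add[OF M])
  finally show ?thesis by (simp add: complex_add_cnj)
qed

text \<open>The exponents are chosen so that \<open>interp_left K r s A ** interp_right K r s C\<close>, with a power
  of \<open>A\<close> between them, is \<open>(K* A^r K)^s\<close> at \<open>z = 1/s\<close>, a product of contractions
  with \<open>(K* A^r K)^s\<close> at \<open>Re z = 0\<close>, and of Hilbert--Schmidt type at \<open>Re z = 1\<close>.\<close>

definition interp_left :: "complex^'n^'n \<Rightarrow> real \<Rightarrow> real \<Rightarrow> complex^'n^'n \<Rightarrow> complex \<Rightarrow> complex^'n^'n" where
  "interp_left K r s A z = cpow (sandwich K r A) (of_real (- (s / 2)) * z + of_real (s - 1 / 2))
     ** ctranspose (root_factor K r A)"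

definition interp_right :: "complex^'n^'n \<Rightarrow> real \<Rightarrow> real \<Rightarrow> complex^'n^'n \<Rightarrow> complex \<Rightarrow> complex^'n^'n" where
  "interp_right K r s C z = cpow C (of_real (- (r * s / 2)) * z + of_real 0)
     ** (root_factor K r C ** cpow (sandwich K r C) (of_real (s / 2) * z + of_real (- (1 / 2))))"

definition interp :: "nat \<Rightarrow> complex^'n^'n \<Rightarrow> real \<Rightarrow> real \<Rightarrow> complex^'n^'n \<Rightarrow> complex^'n^'n \<Rightarrow> complex \<Rightarrow> complex" where
  "interp k K r s A C z = minor_sum k (interp_left K r s A z
     ** (cpow A (of_real (r * s / 2) * z + of_real 0) ** interp_right K r s C z))"

lemma strip_bounded_minor_sum:
  fixes F :: "complex \<Rightarrow> complex^'n^'n"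
  assumes "strip_bounded_matrix F"
  shows "strip_bounded (\<lambda>z. minor_sum k (F z))"
proof -
  have "strip_bounded (\<lambda>z. inverse (fact k) * (\<Sum>f\<in>index_maps k. minor k (F z) f f))"
    using assms unfolding minor_def strip_bounded_matrix_def
    by (intro strip_bounded_mult strip_bounded_const strip_bounded_sum strip_bounded_prod) blast
  thus ?thesis by (simp add: minor_sum_def field_simps)
qed

lemma strip_bounded_interp:
  assumes "A \<in> psd_cone" "C \<in> psd_cone"
  shows "strip_bounded (interp k K r s A C)"
  unfolding interp_def[abs_def] interp_left_def interp_right_def
  by (intro strip_bounded_minor_sum strip_bounded_matrix_mult strip_bounded_matrix_const
      strip_bounded_matrix_cpow psd_cone_sandwich assms)

lemma interp_at:
  fixes A C K :: "complex^'n^'n"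
  assumes A: "A \<in> psd_cone" and C: "C \<in> psd_cone" and le: "\<And>v. qf A v \<le> c * qf C v" and s: "s > 0"
  shows "interp k K r s A C (of_real (1 / s)) = minor_sum k (cpow (sandwich K r A) (of_real s))"
proof -
  let ?M = "sandwich K r C"
  \<comment> \<open>At z = 1/s the power of \<open>?M\<close> in \<open>interp_right\<close> has
    exponent 0, so it leaves the support projection of \<open>?M\<close>, which
    \<open>root_factor K r C\<close> must absorb.\<close>
  have "(norm (root_factor K r C *v v))\<^sup>2 \<le> 1 * qf ?M v" for v
    using qf_gram[of "root_factor K r C" v] by (simp add: sandwich_gram[OF C])
  hence N: "root_factor K r C ** cpow ?M 0 = root_factor K r C"
    by (rule absorb_support[OF psd_cone_sandwich[OF C]])
  have e: "of_real (- (r * s / 2)) * of_real (1 / s) + of_real 0 = - complex_of_real (r / 2)"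
    "of_real (r * s / 2) * of_real (1 / s) + of_real 0 = complex_of_real (r / 2)"
    "of_real (s / 2) * of_real (1 / s) + of_real (- (1 / 2)) = (0::complex)"
    "of_real (- (s / 2)) * of_real (1 / s) + of_real (s - 1 / 2) = complex_of_real (s - 1)"
    using s by (simp_all add: complex_eq_iff field_simps)
  have "cpow A (of_real (r / 2)) ** interp_right K r s C (of_real (1 / s))
      = cpow A (of_real (r / 2)) ** cpow C (- of_real (r / 2)) ** cpow C (of_real (r / 2)) ** K"
    unfolding interp_right_def e N by (simp add: root_factor_def matrix_mul_assoc)
  also have "\<dots> = root_factor K r A"
    unfolding cpow_cancel[OF A C le] root_factor_def ..
  finally have "interp k K r s A C (of_real (1 / s))
      = minor_sum k (cpow (sandwich K r A) (of_real (s - 1)) ** (ctranspose (root_factor K r A) ** root_factor K r A))"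
    unfolding interp_def interp_left_def e by (simp add: matrix_mul_assoc)
  also have "cpow (sandwich K r A) (of_real (s - 1)) ** (ctranspose (root_factor K r A) ** root_factor K r A)
      = cpow (sandwich K r A) (of_real (s - 1)) ** cpow (sandwich K r A) 1"
    by (simp add: sandwich_gram[OF A] cpow_one psd_cone_sandwich[OF A])
  also have "\<dots> = cpow (sandwich K r A) (of_real s)"
    by (simp flip: cpow_add[OF psd_cone_sandwich[OF A]])
  finally show ?thesis .
qed

text \<open>Splitting off \<open>?S\<close> balances the exponents: \<open>?S\<close> and
  \<open>W\<close> have the same Gram matrix, so Cauchy-Schwarz gives E times E once the contraction
  \<open>G\<close> is dropped.\<close>

lemma interp_edge_0:
  fixes A C K :: "complex^'n^'n"
  assumes k: "1 \<le> k" and A: "A \<in> psd_cone" and C: "C \<in> psd_cone" and z: "Re z = 0"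
  shows "norm (interp k K r s A C z) \<le> Re (minor_sum k (cpow (sandwich K r A) (of_real s)))"
proof -
  let ?M = "sandwich K r A" and ?L = "sandwich K r C"
  note M = psd_cone_sandwich[OF A, of K r] and L = psd_cone_sandwich[OF C, of K r]
  define E where "E = Re (minor_sum k (cpow ?M (of_real s)))"
  have E0: "0 \<le> E" unfolding E_def by (intro minor_sum_nonneg psd_cone_cpow M)
  let ?S = "cpow ?M (of_real (s / 2))"
  define a where "a = of_real (- (s / 2)) * z + of_real (s / 2 - 1 / 2)"
  define W where "W = cpow ?M a ** ctranspose (root_factor K r A)"
  define G where "G = cpow A (of_real (r * s / 2) * z + of_real 0) ** interp_right K r s C z"
  have X: "contraction (root_factor K r C ** cpow ?L (of_real (s / 2) * z + of_real (- (1 / 2))))"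
    unfolding contraction_def norm_root_factor_cpow[OF C]
    using contraction_cpow_imaginary[OF L, of "of_real (s / 2) * z"] z
    by (simp add: contraction_def)
  have "contraction G"
    unfolding G_def interp_right_def using z
    by (intro contraction_mult[OF _ contraction_mult[OF _ X]] contraction_cpow_imaginary A C) auto
  hence G: "contraction (ctranspose G)" by (rule contraction_ctranspose)
  have "interp_left K r s A z = ?S ** W"
    unfolding interp_left_def W_def a_def
    by (simp add: matrix_mul_assoc field_simps flip: cpow_add[OF M])
  hence h: "interp k K r s A C z = minor_sum k (?S ** (W ** G))"
    unfolding interp_def G_def by (simp add: matrix_mul_assoc)
  have SS: "?S ** ctranspose ?S = cpow ?M (of_real s)"
    by (simp add: ctranspose_cpow[OF M] flip: cpow_add[OF M])
  have WW: "W ** ctranspose W = cpow ?M (of_real s)"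
    using cpow_sandwich_gram[OF A, of K r a] z by (simp add: W_def a_def)
  \<comment> \<open>Passing to adjoints moves \<open>G\<close> to the outer side, where
    contractivity is an inequality of quadratic forms.\<close>
  have "Re (minor_sum k (ctranspose (W ** G) ** (W ** G)))
      = Re (minor_sum k (ctranspose (ctranspose (W ** G)) ** ctranspose (W ** G)))"
    by (simp add: minor_sum_commute[of k "ctranspose (W ** G)"])
  also have "\<dots> \<le> Re (minor_sum k (ctranspose (ctranspose W) ** ctranspose W))"
  proof (rule minor_sum_mono[OF k psd_cone_gram psd_cone_gram])
    show "qf (ctranspose (ctranspose (W ** G)) ** ctranspose (W ** G)) v
        \<le> qf (ctranspose (ctranspose W) ** ctranspose W) v" for v
      using G unfolding qf_gram unfolding ctranspose_mult contraction_def matrix_vector_mul_assoc[symmetric]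
      by (intro power_mono) auto
  qed
  finally have "Re (minor_sum k (ctranspose (W ** G) ** (W ** G))) \<le> E" by (simp add: WW E_def)
  hence "E * Re (minor_sum k (ctranspose (W ** G) ** (W ** G))) \<le> E * E"
    using E0 by (rule mult_left_mono)
  hence "(norm (interp k K r s A C z))\<^sup>2 \<le> E\<^sup>2"
    using minor_sum_Cauchy_Schwarz[of k ?S "W ** G"]
    unfolding h SS E_def[symmetric] power2_eq_square[of E] by linarith
  thus ?thesis using E0 unfolding E_def by (rule power2_le_imp_le)
qed

text \<open>Here the left family alone has Gram matrix
  \<open>cpow (sandwich K r A) (of_real s)\<close>; its factor is the one that later
  cancels.\<close>

lemma interp_edge_1:
  fixes A C K :: "complex^'n^'n"
  assumes A: "A \<in> psd_cone" and z: "Re z = 1"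
  shows "(norm (interp k K r s A C z))\<^sup>2 \<le> Re (minor_sum k (cpow (sandwich K r A) (of_real s)))
    * Re (minor_sum k (ctranspose (interp_right K r s C z) ** cpow A (of_real (r * s)) ** interp_right K r s C z))"
proof -
  let ?X = "cpow A (of_real (r * s / 2) * z + of_real 0)" and ?Z = "interp_right K r s C z"
  have Y: "interp_left K r s A z ** ctranspose (interp_left K r s A z) = cpow (sandwich K r A) (of_real s)"
    using cpow_sandwich_gram[OF A, of K r "of_real (- (s / 2)) * z + of_real (s - 1 / 2)"] z
    by (simp add: interp_left_def)
  have "ctranspose (?X ** ?Z) ** (?X ** ?Z) = ctranspose ?Z ** (ctranspose ?X ** ?X) ** ?Z"
    unfolding ctranspose_mult by (simp only: matrix_mul_assoc)
  also have "ctranspose ?X ** ?X = cpow A (of_real (r * s))"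
    unfolding cpow_gram[OF A] using z by simp
  finally have G: "ctranspose (?X ** ?Z) ** (?X ** ?Z) = ctranspose ?Z ** cpow A (of_real (r * s)) ** ?Z" .
  show ?thesis
    using minor_sum_Cauchy_Schwarz[of k "interp_left K r s A z" "?X ** ?Z"]
    unfolding Y G interp_def[symmetric] .
qed

text \<open>The powers of \<open>C\<close> combine to an imaginary one, a contraction, and the
  remaining factor acts with the norm of
  \<open>cpow (sandwich K r C) (of_real (s / 2) * z)\<close>.\<close>

lemma interp_right_edge_1:
  fixes C K :: "complex^'n^'n"
  assumes C: "C \<in> psd_cone" and z: "Re z = 1"
  shows "qf (cpow C (of_real (r * s))) (interp_right K r s C z *v v) \<le> qf (cpow (sandwich K r C) (of_real s)) v"
proof -
  let ?M = "sandwich K r C"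
  note M = psd_cone_sandwich[OF C, of K r]
  let ?b = "of_real (s / 2) * z + of_real (- (1 / 2))"
  let ?H = "cpow C (of_real (r * s / 2))"
  have "qf (cpow C (of_real (r * s))) (interp_right K r s C z *v v) = (norm (?H *v (interp_right K r s C z *v v)))\<^sup>2"
    using qf_gram[of ?H "interp_right K r s C z *v v"] by (simp add: cpow_gram[OF C])
  also have "?H *v (interp_right K r s C z *v v)
      = cpow C (of_real (r * s / 2) * (1 - z)) *v ((root_factor K r C ** cpow ?M ?b) *v v)"
    unfolding interp_right_def matrix_vector_mul_assoc matrix_mul_assoc
    by (simp add: right_diff_distrib flip: cpow_add[OF C])
  also have "(norm (\<dots>))\<^sup>2 \<le> (norm ((root_factor K r C ** cpow ?M ?b) *v v))\<^sup>2"
    using contraction_cpow_imaginary[OF C, of "of_real (r * s / 2) * (1 - z)"] z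
    by (intro power_mono) (auto simp: contraction_def)
  also have "\<dots> = (norm (cpow ?M (of_real (s / 2) * z) *v v))\<^sup>2"
    unfolding norm_root_factor_cpow[OF C] by simp
  also have "\<dots> = qf (cpow ?M (of_real s)) v"
    using qf_gram[of "cpow ?M (of_real (s / 2) * z)" v] z by (simp add: cpow_gram[OF M])
  finally show ?thesis .
qed


subsection \<open>Concavity from products\<close>

text \<open>The moduli at \<theta> equal the bounds on Re z = 0. With p = E^m F^n the product is at
  most p on Re z = 0 and sqrt (p M) on Re z = 1, so attaining p inside forces p \<le> M.\<close>

lemma three_lines_product:
  fixes f g :: "complex \<Rightarrow> complex" and u v :: "complex \<Rightarrow> real"
  assumes f: "strip_bounded f" and g: "strip_bounded g"
    and E: "0 \<le> E" and F: "0 \<le> F" and M: "0 < M"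
    and f0: "\<And>z. Re z = 0 \<Longrightarrow> norm (f z) \<le> E" and g0: "\<And>z. Re z = 0 \<Longrightarrow> norm (g z) \<le> F"
    and f1: "\<And>z. Re z = 1 \<Longrightarrow> (norm (f z))\<^sup>2 \<le> E * u z"
    and g1: "\<And>z. Re z = 1 \<Longrightarrow> (norm (g z))\<^sup>2 \<le> F * v z"
    and uv: "\<And>z. Re z = 1 \<Longrightarrow> u z ^ m * v z ^ n \<le> M"
    and \<theta>: "0 < \<theta>" "\<theta> \<le> 1" and fE: "norm (f (of_real \<theta>)) = E" and gF: "norm (g (of_real \<theta>)) = F"
  shows "E ^ m * F ^ n \<le> M"
proof (cases "E ^ m * F ^ n = 0")
  case True
  show ?thesis unfolding True using M by simp
next
  case False
  define p where "p = E ^ m * F ^ n"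
  have "0 \<le> p" unfolding p_def by (intro mult_nonneg_nonneg zero_le_power E F)
  moreover have "p \<noteq> 0" unfolding p_def by (rule False)
  ultimately have p: "0 < p" by linarith
  \<comment> \<open>The factor exp (z D) turns the bound sqrt (p M) on Re z = 1 into p, the bound on
    Re z = 0.\<close>
  define D where "D = ln (p / M) / 2"
  define H where "H z = f z ^ m * g z ^ n * exp ((of_real 1 * z + of_real 0) * of_real D)" for z
  have nH: "norm (H z) = norm (f z) ^ m * norm (g z) ^ n * exp (Re z * D)" for z
    by (simp add: H_def norm_mult norm_power)
  have "strip_bounded H"
    unfolding H_def by (intro strip_bounded_mult strip_bounded_power strip_bounded_exp_affine f g)
  moreover have "norm (H z) \<le> p" if "Re z = 0 \<or> Re z = 1" for z
    using that
  proof
    assume z: "Re z = 0"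
    thus ?thesis
      unfolding nH p_def using f0[OF z] g0[OF z] by (simp add: mult_mono power_mono E F)
  next
    assume z: "Re z = 1"
    have "(norm (f z) ^ m * norm (g z) ^ n)\<^sup>2 = ((norm (f z))\<^sup>2) ^ m * ((norm (g z))\<^sup>2) ^ n"
      by (simp add: power_mult_distrib flip: power_mult) (simp add: mult.commute)
    also have "\<dots> \<le> (E * u z) ^ m * (F * v z) ^ n"
      using f1[OF z] g1[OF z] order_trans[OF zero_le_power2 f1[OF z]]
      by (intro mult_mono power_mono zero_le_power) auto
    also have "\<dots> = p * (u z ^ m * v z ^ n)" by (simp add: p_def power_mult_distrib)
    also have "\<dots> \<le> p * M" using uv[OF z] p by simp
    finally have 1: "(norm (f z) ^ m * norm (g z) ^ n)\<^sup>2 \<le> p * M" .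
    have "(exp D)\<^sup>2 = p / M" using p M by (simp add: D_def flip: exp_double)
    hence "(norm (f z) ^ m * norm (g z) ^ n * exp D)\<^sup>2 \<le> p * M * (p / M)"
      unfolding power_mult_distrib[of "norm (f z) ^ m * norm (g z) ^ n" "exp D"]
      using 1 p M by (intro mult_mono) auto
    also have "p * M * (p / M) = p\<^sup>2" using M unfolding power2_eq_square by simp
    finally have "norm (f z) ^ m * norm (g z) ^ n * exp D \<le> p"
      by (rule power2_le_imp_le) (rule less_imp_le[OF p])
    thus ?thesis using z by (simp add: nH)
  qed
  moreover have "of_real \<theta> \<in> strip" using \<theta> by (simp add: strip_def)
  ultimately have "norm (H (of_real \<theta>)) \<le> p"
    using strip_maximum_principle[of H p "of_real \<theta>"] by blast
  hence "p * exp (\<theta> * D) \<le> p * 1" by (simp add: nH fE gF p_def)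
  hence "exp (\<theta> * D) \<le> 1" using p by (simp only: mult_le_cancel_left_pos)
  hence "D \<le> 0" using \<theta> by (simp add: mult_le_0_iff)
  hence "ln (p / M) \<le> ln 1" by (simp add: D_def)
  hence "p / M \<le> 1" using p M by (subst (asm) ln_le_cancel_iff) auto
  thus ?thesis using M by (simp add: p_def)
qed

text \<open>Exponents of possibly vanishing holomorphic functions must be natural numbers. A
  rational just below w overshoots only the second weight, within the slack \<rho>.\<close>

lemma rational_weight_approximation:
  fixes w \<rho> :: real
  assumes "0 < w" "w < 1" "1 < \<rho>"
  obtains m n :: nat where "0 < m" "0 < n"
    "real m / real (m + n) \<le> \<rho> * w" "real n / real (m + n) \<le> \<rho> * (1 - w)"
proof -
  define t where "t = \<rho> * (1 - w)"
  have "1 * (1 - w) < t" unfolding t_def using assms by (intro mult_strict_right_mono) auto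
  hence "1 - t < w" by simp
  hence "1 - \<rho> * (1 - w) < w" by (simp only: t_def)
  hence "max 0 (1 - \<rho> * (1 - w)) < w" using assms by (simp only: max_less_iff_conj)
  then obtain q where q: "q \<in> \<rat>" "max 0 (1 - \<rho> * (1 - w)) < q" "q < w"
    using Rats_dense_in_real by blast
  then obtain m N :: nat where mN: "N \<noteq> 0" "\<bar>q\<bar> = real m / real N"
    by (auto elim: Rats_abs_nat_div_natE)
  hence qm: "q = real m / real N" using q by simp
  have "0 < m" using q qm by (cases m) auto
  moreover have "real m / real N < 1" using q(3) assms(2) unfolding qm by linarith
  hence "m < N" using mN(1) by (simp add: divide_less_eq)
  moreover have "1 * w \<le> \<rho> * w" using assms by (intro mult_right_mono) auto
  hence "q \<le> \<rho> * w" using q by linarith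
  moreover have "real (N - m) / real N = 1 - q" using mN \<open>m < N\<close> by (simp add: qm of_nat_diff field_simps)
  moreover have "1 - q \<le> \<rho> * (1 - w)" using q by simp
  ultimately show ?thesis using that[of m "N - m"] qm by simp
qed

lemma weighted_power_mean:
  fixes x y \<kappa> :: real
  assumes "0 \<le> x" "0 \<le> y" "0 < m" "0 < n" "0 \<le> \<kappa>"
    and le: "real m / real (m + n) * x + real n / real (m + n) * y \<le> \<kappa>"
  shows "x ^ m * y ^ n \<le> \<kappa> ^ (m + n)"
proof (cases "x = 0 \<or> y = 0")
  case True
  thus ?thesis using assms by (auto simp: zero_power)
next
  case False
  hence p: "0 < x" "0 < y" using assms by auto
  let ?a = "real m / real (m + n)" and ?b = "real n / real (m + n)"
  have pow: "(c powr (real j / real (m + n))) ^ (m + n) = c ^ j" if "0 < c" for c and j :: nat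
    using that assms by (simp add: powr_powr flip: powr_realpow del: of_nat_add)
  have "x powr ?a * y powr ?b \<le> \<kappa>"
  proof (rule order_trans[OF Young_nonneg le])
    show "?a + ?b = 1" using assms by (simp flip: add_divide_distrib)
  qed (use p in auto)
  hence "(x powr ?a * y powr ?b) ^ (m + n) \<le> \<kappa> ^ (m + n)" by (intro power_mono) auto
  thus ?thesis by (simp only: power_mult_distrib pow[OF p(1)] pow[OF p(2)])
qed

text \<open>If the sum T exceeded S, weights close to a \<alpha> / T and b \<beta> / T would bound
  x^m y^n by \<alpha>^m \<beta>^n \<kappa>^(m + n) with \<kappa> < 1, against
  \<open>prod\<close>.\<close>

lemma weighted_sum_le_of_products:
  fixes x y :: "'b \<Rightarrow> real"
  assumes a: "0 < a" and b: "0 < b" and \<alpha>: "0 \<le> \<alpha>" and \<beta>: "0 \<le> \<beta>" and S: "0 \<le> S"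
    and x: "\<And>z. z \<in> L \<Longrightarrow> 0 \<le> x z" and y: "\<And>z. z \<in> L \<Longrightarrow> 0 \<le> y z"
    and le: "\<And>z. z \<in> L \<Longrightarrow> a * x z + b * y z \<le> S"
    and prod: "\<And>(m::nat) n M. 0 < M \<Longrightarrow> (\<And>z. z \<in> L \<Longrightarrow> x z ^ m * y z ^ n \<le> M) \<Longrightarrow> \<alpha> ^ m * \<beta> ^ n \<le> M"
  shows "a * \<alpha> + b * \<beta> \<le> S"
proof (rule ccontr)
  define T where "T = a * \<alpha> + b * \<beta>"
  assume "\<not> a * \<alpha> + b * \<beta> \<le> S"
  hence ST: "S < T" by (simp add: T_def)
  hence T: "0 < T" using S by simp
  \<comment> \<open>Chosen so that \<rho> > 1 and yet \<rho> S / T = 2 S / (S + T) < 1.\<close>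
  define \<rho> where "\<rho> = 2 * T / (S + T)"
  have \<rho>: "1 < \<rho>" using ST S T by (simp add: \<rho>_def field_simps)
  \<comment> \<open>The value 1/2 keeps \<kappa> positive when S = 0; the terms \<beta> / 2 and
    \<alpha> / 2 in the degenerate cases do the same for the bound passed to
    \<open>prod\<close>.\<close>
  define \<kappa> where "\<kappa> = max (1 / 2) (\<rho> * S / T)"
  have "\<rho> * S / T = 2 * S / (S + T)" using T by (simp add: \<rho>_def)
  also have "\<dots> < 1" using ST S T by (simp add: field_simps)
  finally have \<kappa>: "0 < \<kappa>" "\<kappa> < 1" "\<rho> * S / T \<le> \<kappa>" by (auto simp: \<kappa>_def)
  consider "\<alpha> = 0" | "\<beta> = 0" | "0 < \<alpha>" "0 < \<beta>" using \<alpha> \<beta> by linarith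
  thus False
  proof cases
    case 1
    hence \<beta>0: "\<beta> = T / b" using b by (simp add: T_def)
    have "\<alpha> ^ 0 * \<beta> ^ 1 \<le> max (S / b) (\<beta> / 2)"
    proof (rule prod)
      show "0 < max (S / b) (\<beta> / 2)" using T b by (simp add: \<beta>0 less_max_iff_disj)
      show "x z ^ 0 * y z ^ 1 \<le> max (S / b) (\<beta> / 2)" if z: "z \<in> L" for z
      proof -
        have "b * y z \<le> S" using le[OF z] x[OF z] a by (smt (verit) mult_nonneg_nonneg)
        thus ?thesis using b by (simp add: le_max_iff_disj field_simps)
      qed
    qed
    moreover have "0 < \<beta>" using T b by (simp add: \<beta>0)
    moreover have "S / b < \<beta>" using ST b by (simp add: \<beta>0 divide_strict_right_mono)
    ultimately show False by simp
  next
    case 2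
    hence \<alpha>0: "\<alpha> = T / a" using a by (simp add: T_def)
    have "\<alpha> ^ 1 * \<beta> ^ 0 \<le> max (S / a) (\<alpha> / 2)"
    proof (rule prod)
      show "0 < max (S / a) (\<alpha> / 2)" using T a by (simp add: \<alpha>0 less_max_iff_disj)
      show "x z ^ 1 * y z ^ 0 \<le> max (S / a) (\<alpha> / 2)" if z: "z \<in> L" for z
      proof -
        have "a * x z \<le> S" using le[OF z] y[OF z] b by (smt (verit) mult_nonneg_nonneg)
        thus ?thesis using a by (simp add: le_max_iff_disj field_simps)
      qed
    qed
    moreover have "0 < \<alpha>" using T a by (simp add: \<alpha>0)
    moreover have "S / a < \<alpha>" using ST a by (simp add: \<alpha>0 divide_strict_right_mono)
    ultimately show False by simp
  next
    case 3
    \<comment> \<open>With these weights a x + b y = T (w x / \<alpha> + (1 - w) y /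
      \<beta>).\<close>
    define w where "w = a * \<alpha> / T"
    have w1: "1 - w = b * \<beta> / T" using T by (simp add: w_def T_def field_simps)
    have "0 < 1 - w" unfolding w1 using 3 b T by simp
    moreover have "0 < w" using 3 a T by (simp add: w_def)
    ultimately have w: "0 < w" "w < 1" by simp_all
    obtain m n :: nat where mn: "0 < m" "0 < n"
      "real m / real (m + n) \<le> \<rho> * w" "real n / real (m + n) \<le> \<rho> * (1 - w)"
      using rational_weight_approximation[OF w \<rho>] .
    have "\<alpha> ^ m * \<beta> ^ n \<le> \<alpha> ^ m * \<beta> ^ n * \<kappa> ^ (m + n)"
    proof (rule prod)
      show "0 < \<alpha> ^ m * \<beta> ^ n * \<kappa> ^ (m + n)" using 3 \<kappa> by simp
      show "x z ^ m * y z ^ n \<le> \<alpha> ^ m * \<beta> ^ n * \<kappa> ^ (m + n)" if z: "z \<in> L" for z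
      proof -
        have xy: "0 \<le> x z / \<alpha>" "0 \<le> y z / \<beta>" using x[OF z] y[OF z] 3 by auto
        have "real m / real (m + n) * (x z / \<alpha>) + real n / real (m + n) * (y z / \<beta>)
            \<le> \<rho> * w * (x z / \<alpha>) + \<rho> * (1 - w) * (y z / \<beta>)"
          using mn xy by (intro add_mono mult_right_mono) auto
        also have "\<dots> = \<rho> * (a * x z + b * y z) / T"
        proof -
          have "\<rho> * w * (x z / \<alpha>) = \<rho> * (a * x z) / T" using 3 by (simp add: w_def)
          moreover have "\<rho> * (1 - w) * (y z / \<beta>) = \<rho> * (b * y z) / T" using 3 by (simp add: w1)
          ultimately show ?thesis by (simp only: add_divide_distrib distrib_left)
        qed
        also have "\<dots> \<le> \<rho> * S / T"
          using le[OF z] \<rho> T by (intro divide_right_mono mult_left_mono) auto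
        also have "\<dots> \<le> \<kappa>" by (rule \<kappa>(3))
        finally have "(x z / \<alpha>) ^ m * (y z / \<beta>) ^ n \<le> \<kappa> ^ (m + n)"
          using xy mn \<kappa> by (intro weighted_power_mean) auto
        hence "\<alpha> ^ m * \<beta> ^ n * ((x z / \<alpha>) ^ m * (y z / \<beta>) ^ n) \<le> \<alpha> ^ m * \<beta> ^ n * \<kappa> ^ (m + n)"
          using 3 by (intro mult_left_mono) auto
        moreover have "\<alpha> ^ m * \<beta> ^ n * ((x z / \<alpha>) ^ m * (y z / \<beta>) ^ n) = x z ^ m * y z ^ n"
          using 3 by (simp add: power_divide)
        ultimately show ?thesis by simp
      qed
    qed
    moreover have "\<kappa> ^ (m + n) < 1" using \<kappa> mn by (simp add: power_less_one_iff)
    hence "\<alpha> ^ m * \<beta> ^ n * \<kappa> ^ (m + n) < \<alpha> ^ m * \<beta> ^ n * 1"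
      using 3 by (intro mult_strict_left_mono) auto
    ultimately show False by simp
  qed
qed

subsection \<open>Small and large outer exponents\<close>

lemma phi_psd: "X \<in> psd_cone \<Longrightarrow> phi k X = Re (minor_sum k X) powr (1 / real k)"
  by (simp add: phi_def trace_k_eq_minor_sum)

lemma root_power:
  assumes "0 \<le> x" "1 \<le> k"
  shows "(x powr (1 / real k)) ^ k = x"
  using assms by (cases "x = 0") (auto simp: powr_powr simp flip: powr_realpow)

lemma Loewner_Heinz_sandwich:
  fixes A B C K :: "complex^'n^'n"
  assumes "A \<in> psd_cone" "B \<in> psd_cone" "C \<in> psd_cone" "0 < a" "0 < b" "a + b = 1"
    and "\<And>v. a * qf A v + b * qf B v \<le> qf C v" and "0 \<le> r" "r \<le> 1"
  shows "a * qf (sandwich K r A) v + b * qf (sandwich K r B) v \<le> qf (sandwich K r C) v"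
  unfolding sandwich_def qf_congruence using assms by (intro Loewner_Heinz_concave) auto

lemma concave_sandwich_small_power:
  fixes A B C K :: "complex^'n^'n"
  assumes k: "1 \<le> k" and A: "A \<in> psd_cone" and B: "B \<in> psd_cone" and C: "C \<in> psd_cone"
    and a: "0 < a" and b: "0 < b" and ab: "a + b = 1"
    and le: "\<And>v. a * qf A v + b * qf B v \<le> qf C v"
    and r: "0 \<le> r" "r \<le> 1" and s: "0 \<le> s" "s \<le> 1"
  defines "F \<equiv> \<lambda>X. Re (minor_sum k (cpow (sandwich K r X) (of_real s))) powr (1 / real k)"
  shows "a * F A + b * F B \<le> F C"
  unfolding F_def
proof (intro minor_sum_root_concave k psd_cone_cpow psd_cone_sandwich A B C)
  show "a * qf (cpow (sandwich K r A) (of_real s)) v + b * qf (cpow (sandwich K r B) (of_real s)) v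
      \<le> qf (cpow (sandwich K r C) (of_real s)) v" for v
    using Loewner_Heinz_sandwich[OF A B C a b ab le r]
    by (intro Loewner_Heinz_concave psd_cone_sandwich A B C a b s) (simp_all add: ab)
qed (use a b in auto)

lemma concave_sandwich_large_power:
  fixes A B C K :: "complex^'n^'n"
  assumes k: "1 \<le> k" and A: "A \<in> psd_cone" and B: "B \<in> psd_cone" and C: "C \<in> psd_cone"
    and a: "0 < a" and b: "0 < b" and ab: "a + b = 1"
    and le: "\<And>v. a * qf A v + b * qf B v \<le> qf C v"
    and r: "0 \<le> r" and s: "1 \<le> s" and rs: "r * s \<le> 1"
  defines "F \<equiv> \<lambda>X. Re (minor_sum k (cpow (sandwich K r X) (of_real s))) powr (1 / real k)"
  shows "a * F A + b * F B \<le> F C"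
proof -
  define E where "E X = Re (minor_sum k (cpow (sandwich K r X) (of_real s)))" for X
  have E0: "0 \<le> E X" if "X \<in> psd_cone" for X
    unfolding E_def by (intro minor_sum_nonneg psd_cone_cpow psd_cone_sandwich that)
  let ?Z = "interp_right K r s C"
  define U where "U X z = ctranspose (?Z z) ** cpow X (of_real (r * s)) ** ?Z z" for X z
  have Upsd: "U X z \<in> psd_cone" if "X \<in> psd_cone" for X z
    unfolding U_def by (intro psd_cone_congruence psd_cone_cpow that)
  define x where "x X z = Re (minor_sum k (U X z)) powr (1 / real k)" for X z
  have leA: "\<And>v. qf A v \<le> (1 / a) * qf C v"
    using qf_le_of_combination[OF a less_imp_le[OF b] B le] .
  have leB: "\<And>v. qf B v \<le> (1 / b) * qf C v"
    using qf_le_of_combination[OF b less_imp_le[OF a] A, of B C] le by (simp add: add.commute)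
  have pk: "(x X z) ^ k = Re (minor_sum k (U X z))" if "X \<in> psd_cone" for X z
    unfolding x_def by (intro root_power minor_sum_nonneg Upsd that k)
  have Fk: "(F X) ^ k = E X" if "X \<in> psd_cone" for X
    unfolding F_def E_def[symmetric] by (intro root_power E0 that k)
  have inside: "norm (interp k K r s X C (of_real (1 / s))) = E X"
    if X: "X \<in> psd_cone" and dom: "\<And>v. qf X v \<le> c * qf C v" for X c
  proof -
    have "minor_sum k (cpow (sandwich K r X) (of_real s)) = of_real (E X)"
    proof (rule cpow_diagE[OF psd_cone_cpow[OF psd_cone_sandwich[OF X, of K r], of s]], goal_cases)
      case (1 V d)
      show ?case unfolding E_def minor_sum_psd[OF 1(1,2)] by simp
    qed
    thus ?thesis using interp_at[OF X C dom, of s k K r] s E0[OF X] by simp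
  qed
  show ?thesis
  proof (rule weighted_sum_le_of_products[where x = "x A" and y = "x B" and L = "{z. Re z = 1}"])
    show "a * x A z + b * x B z \<le> F C" if "z \<in> {z. Re z = 1}" for z
      unfolding x_def F_def
    proof (intro minor_sum_root_concave k Upsd psd_cone_cpow psd_cone_sandwich A B C)
      fix v
      \<comment> \<open>Here r s \<le> 1 enters: the combined power is operator concave although the
        outer power alone need not be.\<close>
      have "a * qf (U A z) v + b * qf (U B z) v \<le> qf (cpow C (of_real (r * s))) (?Z z *v v)"
        unfolding U_def qf_congruence using r s rs ab
        by (intro Loewner_Heinz_concave A B C a b le) auto
      also have "\<dots> \<le> qf (cpow (sandwich K r C) (of_real s)) v"
        using that by (intro interp_right_edge_1 C) simp
      finally show "a * qf (U A z) v + b * qf (U B z) v \<le> qf (cpow (sandwich K r C) (of_real s)) v" .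
    qed (use a b in auto)
  next
    fix m n :: nat and M :: real
    assume M: "0 < M" and bound: "\<And>z. z \<in> {z. Re z = 1} \<Longrightarrow> x A z ^ m * x B z ^ n \<le> M"
    \<comment> \<open>The sought inequality concerns the roots \<open>F\<close>, the three lines
      theorem their k-th powers \<open>E\<close>; hence the bound \<open>M ^ k\<close>.\<close>
    have EM: "E A ^ m * E B ^ n \<le> M ^ k"
    proof (rule three_lines_product[where f = "interp k K r s A C" and g = "interp k K r s B C"
          and u = "\<lambda>z. x A z ^ k" and v = "\<lambda>z. x B z ^ k" and \<theta> = "1 / s"])
      fix z :: complex assume z: "Re z = 1"
      show "(norm (interp k K r s A C z))\<^sup>2 \<le> E A * x A z ^ k"
        unfolding pk[OF A] E_def U_def by (rule interp_edge_1[OF A z])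
      show "(norm (interp k K r s B C z))\<^sup>2 \<le> E B * x B z ^ k"
        unfolding pk[OF B] E_def U_def by (rule interp_edge_1[OF B z])
      have "(x A z ^ k) ^ m * (x B z ^ k) ^ n = (x A z ^ m * x B z ^ n) ^ k"
        by (simp add: power_mult_distrib flip: power_mult) (simp add: mult.commute)
      also have "\<dots> \<le> M ^ k" using bound z by (intro power_mono) (auto simp: x_def)
      finally show "(x A z ^ k) ^ m * (x B z ^ k) ^ n \<le> M ^ k" .
    next
      fix z :: complex assume z: "Re z = 0"
      show "norm (interp k K r s A C z) \<le> E A" unfolding E_def by (rule interp_edge_0[OF k A C z])
      show "norm (interp k K r s B C z) \<le> E B" unfolding E_def by (rule interp_edge_0[OF k B C z])
    next
      show "norm (interp k K r s A C (of_real (1 / s))) = E A" by (rule inside[OF A leA])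
      show "norm (interp k K r s B C (of_real (1 / s))) = E B" by (rule inside[OF B leB])
    qed (use s M in \<open>auto intro: strip_bounded_interp E0 A B C\<close>)
    have "(F A ^ m * F B ^ n) ^ k = (F A ^ k) ^ m * (F B ^ k) ^ n"
      unfolding power_mult_distrib power_mult[symmetric] by (simp only: mult.commute)
    also have "\<dots> \<le> M ^ k" using EM unfolding Fk[OF A] Fk[OF B] .
    also have "k = Suc (k - 1)" using k by simp
    finally show "F A ^ m * F B ^ n \<le> M" using M by (rule power_le_imp_le_base[OF _ less_imp_le])
  qed (use a b in \<open>auto simp: F_def x_def\<close>)
qed

lemma convex_psd_cone: "convex (psd_cone :: (complex^'n^'n) set)"
  by (auto simp: convex_def intro: psd_cone_combine)

theorem lemma3p1:
  fixes k :: nat and r s :: real and K :: "complex^'n^'n"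
  assumes "1 \<le> k" and "k \<le> CARD('n)"
    and "0 \<le> r" and "r \<le> 1"
    and "0 \<le> s" and "r \<noteq> 0 \<longrightarrow> s \<le> 1 / r"
  shows "concave_on (psd_cone :: (complex^'n^'n) set)
           (\<lambda>A. phi k (psd_power (ctranspose K ** psd_power A r ** K) s))"
proof -
  let ?f = "\<lambda>A. phi k (psd_power (ctranspose K ** psd_power A r ** K) s)"
  have "a * ?f A + b * ?f B \<le> ?f (a *\<^sub>R A + b *\<^sub>R B)"
    if A: "A \<in> psd_cone" and B: "B \<in> psd_cone" and a: "0 \<le> a" and b: "0 \<le> b" and ab: "a + b = 1"
    for A B :: "complex^'n^'n" and a b
  proof -
    define C where "C = a *\<^sub>R A + b *\<^sub>R B"
    have C: "C \<in> psd_cone" unfolding C_def by (intro psd_cone_combine A B a b)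
    have le: "a * qf A v + b * qf B v \<le> qf C v" for v
      by (simp add: C_def qf_add qf_scaleR)
    \<comment> \<open>An exponent 0 makes the function constant, by the convention on zeroth powers;
      the interpolation needs both weights strictly positive to dominate \<open>A\<close> and
      \<open>B\<close> by multiples of \<open>C\<close>.\<close>
    consider "r = 0 \<or> s = 0" | "a = 0 \<or> b = 0" | "r \<noteq> 0" "s \<noteq> 0" "a \<noteq> 0" "b \<noteq> 0" by blast
    thus ?thesis
    proof cases
      case 1
      have "?f X = ?f C" if X: "X \<in> psd_cone" for X
      proof (cases "r = 0")
        case True
        thus ?thesis by (simp add: psd_power_zero X C)
      next
        case False
        hence "psd_power (ctranspose K ** psd_power Y r ** K) s = mat 1" if "Y \<in> psd_cone" for Y
          using 1 that by (simp add: psd_power_eq_cpow psd_power_zero psd_cone_congruence psd_cone_cpow)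
        thus ?thesis using X C by simp
      qed
      from this[OF A] this[OF B] show ?thesis
        using ab by (simp add: C_def flip: distrib_right)
    next
      case 2
      thus ?thesis using ab by auto
    next
      case 3
      define F where "F X = Re (minor_sum k (cpow (sandwich K r X) (of_real s))) powr (1 / real k)" for X
      have f: "?f X = F X" if "X \<in> psd_cone" for X
        using 3 psd_cone_sandwich[OF that, of K r] psd_cone_cpow[OF psd_cone_sandwich[OF that, of K r], of s]
        by (simp add: F_def psd_power_eq_cpow that phi_psd flip: sandwich_def)
      have "a * F A + b * F B \<le> F C"
      proof (cases "s \<le> 1")
        case True
        show ?thesis unfolding F_def
          using concave_sandwich_small_power[OF assms(1) A B C _ _ ab le assms(3,4,5) True] a b 3 by simp
      next
        case False
        have "r * s \<le> 1" using assms 3 by (simp add: field_simps)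
        thus ?thesis unfolding F_def
          using concave_sandwich_large_power[OF assms(1) A B C _ _ ab le assms(3)] a b 3 False by simp
      qed
      thus ?thesis by (simp only: f A B C flip: C_def)
    qed
  qed
  thus ?thesis unfolding concave_on_iff using convex_psd_cone by blast
qed

end
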